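(* Let $\mathcal V=[n]=\{1,\dots,n\}$, and let $\mathcal G=(\mathcal V,\mathcal E,W)$ be a weighted undirected graph with edge set $\mathcal E\subset\{\{i,j\}: i,j\in\mathcal V,\ i\ne j\}$ and non-negative weights $W=(w_{\{i,j\}})_{\{i,j\}\in\mathcal E}$; set $w_{\{i,j\}}=0$ whenever $\{i,j\}\notin\mathcal E$. Suppose that $f_i:\mathbb R^p\to\mathbb R$ is strictly convex and $L_i$-smooth for each $i\in\mathcal V$. Let $\mathcal P=\{C_1,\dots,C_N\}$ be the (unseen) true partitioning of $\mathcal V$, and let $f^{(k)}:=\sum_{i\in C_k}f_i$ for $k\in[N]$. Assume that for each $k\in[N]$ the function $f^{(k)}$ is $\alpha_k$-strongly convex, and let $\overline x^{(k)}=\operatorname{argmin}_{x\in\mathbb R^p}f^{(k)}(x)$. Suppose that $\overline x^{(k)}\neq\overline x^{(k')}$ for $k\ne k'$. With $n_k:=|C_k|$, $w_i^{(k)}:=\sum_{j\in C_k}w_{\{i,j\}}$ and $w^{(k,k')}:=\sum_{i\in C_k}\sum_{j\in C_{k'}}w_{\{i,j\}}$, let $$\mu_{ij}^{(k)}=\sum_{l\ne k}\left|w_i^{(l)}-w_j^{(l)}\right|+\frac{L_i+L_j}{\alpha_k}\sum_{l\neq k}w^{(k,l)},\qquad i,j\in C_k,\ k\in[N],$$ and suppose that $n_kw_{\{i,j\}}>\mu_{ij}^{(k)}$ for all $k\in[N]$ and all $i,j\in C_k$ with $i\ne j$. Let $$\gamma_{\max}:=\min_{k\ne k'}\left\{\frac{\|\overline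 x^{(k)}-\overline x^{(k')}\|_2}{\frac1{\alpha_k}\sum_{l\ne k}w^{(k,l)}+\frac1{\alpha_{k'}}\sum_{l\ne k'}w^{(k',l)}}\right\},\qquad \gamma_{\min}:=\max_k\max_{\substack{i,j\in C_k\\ i\ne j}}\left\{\frac{\|\nabla f_j(\overline x^{(k)})-\nabla f_i(\overline x^{(k)})\|_2}{n_kw_{\{i,j\}}-\mu_{ij}^{(k)}}\right\},$$ where we set $\frac a0=\infty$ for $a>0$. Let $\gamma>0$, let $(x_1^*,\dots,x_n^* )$ be an optimal solution of $$\underset{x_1,\dots,x_n\in\mathbb R^p}{\text{minimize}}\quad\sum_{i\in\mathcal V}f_i(x_i)+\gamma\sum_{\{i,j\}\in\mathcal E}w_{\{i,j\}}\|x_i-x_j\|_2,$$ and let $\overline{\mathcal P}$ be the quotient set of $\mathcal V$ by the equivalence relation $x_i^*=x_j^*$ (that is, $i\sim j\iff x_i^*=x_j^*$). Then: 1. If $\gamma_{\min}\le\gamma<\gamma_{\max}$, then $\overline{\mathcal P}$ perfectly recovers $\mathcal P$. 2. If $\gamma_{\min}\le\gamma<\max_k\dfrac{\|\nabla f^{(k)}(\overline x)\|_2}{\sum_{l\ne k}w^{(k,l)}}$, then $\overline{\mathcal P}$ is a non-trivial coarsening of $\mathcal P$, where $$\overline x:=\operatorname{argmin}_{x\in\mathbb R^p}\sum_{k\in[N]}f^{(k)}(x)=\operatorname{argmin}_{x\in\mathbb R^p}\sum_{i\in\mathcal V}f_i(x).$$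
   Context: A continuously differentiable function $f:\mathbb R^p\to\mathbb R$ is $L$-smooth ($L>0$) if $\|\nabla f(x)-\nabla f(y)\|_2\le L\|x-y\|_2$ for all $x,y\in\mathbb R^p$. A function $f:\mathbb R^p\to\mathbb R$ is $\alpha$-strongly convex ($\alpha>0$) if $f-\frac{\alpha}{2}\|\cdot\|_2^2$ is convex. Here $[N]=\{1,\dots,N\}$ and $\|\cdot\|_2$ is the Euclidean norm. The clusters $C_1,\dots,C_N$ of a partitioning of $\mathcal V$ are pairwise disjoint with union $\mathcal V$. For partitionings $\mathcal P=\{C_1,\dots,C_N\}$ and $\overline{\mathcal P}=\{\overline C_1,\dots,\overline C_M\}$ of $\mathcal V$: $\overline{\mathcal P}$ perfectly recovers $\mathcal P$ if $\overline{\mathcal P}=\mathcal P$; $\overline{\mathcal P}$ is a coarsening of $\mathcal P$ if for every $\overline C\in\overline{\mathcal P}$ there is $I\subset\{1,\dots,N\}$ with $\overline C=\bigcup_{l\in I}C_l$. A coarsening is called trivial if $\overline{\mathcal P}=\{\mathcal V\}$, and non-trivial otherwise. *)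

theory Defs
  imports "HOL-Analysis.Analysis"
begin

definition grad :: "('a::real_inner \<Rightarrow> real) \<Rightarrow> 'a \<Rightarrow> 'a" where
  "grad f x = (THE D. GDERIV f x :> D)"

definition smooth_fun :: "real \<Rightarrow> ('a::real_inner \<Rightarrow> real) \<Rightarrow> bool" where
  "smooth_fun L f \<longleftrightarrow> L > 0 \<and> (\<forall>x. f differentiable (at x)) \<and> continuous_on UNIV (grad f) \<and>
     (\<forall>x y. norm (grad f x - grad f y) \<le> L * norm (x - y))"

definition strictly_convex :: "('a::real_vector \<Rightarrow> real) \<Rightarrow> bool" where
  "strictly_convex f \<longleftrightarrow> (\<forall>x y t. x \<noteq> y \<longrightarrow> 0 < t \<longrightarrow> t < 1 \<longrightarrow>
     f ((1 - t) *\<^sub>R x + t *\<^sub>R y) < (1 - t) * f x + t * f y)"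

definition strongly_convex :: "real \<Rightarrow> ('a::real_normed_vector \<Rightarrow> real) \<Rightarrow> bool" where
  "strongly_convex \<alpha> f \<longleftrightarrow> \<alpha> > 0 \<and> convex_on UNIV (\<lambda>x. f x - \<alpha> / 2 * (norm x)\<^sup>2)"

definition cluster_fun :: "(nat \<Rightarrow> 'a \<Rightarrow> real) \<Rightarrow> nat set \<Rightarrow> 'a \<Rightarrow> real" where
  "cluster_fun f A x = (\<Sum>i\<in>A. f i x)"

(* arg_min is a choice operator; it is only meaningful when a minimizer exists, and it denotes
   the unique minimizer in the strongly convex case. *)
definition argmin :: "('a \<Rightarrow> real) \<Rightarrow> 'a" where
  "argmin g = arg_min g (\<lambda>_. True)"

(* A weight function is a function w on unordered pairs {i, j}, extended by 0 off the edge set.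
   Since {i, i} = {i} is never an edge, it contributes 0 to the sums below. *)
definition weight_to :: "(nat set \<Rightarrow> real) \<Rightarrow> nat set \<Rightarrow> nat \<Rightarrow> real" where
  "weight_to w A i = (\<Sum>j\<in>A. w {i, j})"

definition weight_between :: "(nat set \<Rightarrow> real) \<Rightarrow> nat set \<Rightarrow> nat set \<Rightarrow> real" where
  "weight_between w A B = (\<Sum>i\<in>A. \<Sum>j\<in>B. w {i, j})"

definition out_weight :: "(nat set \<Rightarrow> real) \<Rightarrow> nat \<Rightarrow> (nat \<Rightarrow> nat set) \<Rightarrow> nat \<Rightarrow> real" where
  "out_weight w N C k = (\<Sum>l\<in>{1..N} - {k}. weight_between w (C k) (C l))"

definition mu :: "(nat set \<Rightarrow> real) \<Rightarrow> nat \<Rightarrow> (nat \<Rightarrow> nat set) \<Rightarrow> (nat \<Rightarrow> real) \<Rightarrow> (nat \<Rightarrow> real) \<Rightarrow>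
    nat \<Rightarrow> nat \<Rightarrow> nat \<Rightarrow> real" where
  "mu w N C L \<alpha> k i j =
     (\<Sum>l\<in>{1..N} - {k}. \<bar>weight_to w (C l) i - weight_to w (C l) j\<bar>) +
     (L i + L j) / \<alpha> k * out_weight w N C k"

(* The thresholds live in the extended reals. There a / 0 = \<infinity> for a > 0 and 0 / 0 = 0, and the
   minimum (maximum) over an empty index set is \<infinity> (-\<infinity>). *)
definition gamma_max :: "(nat \<Rightarrow> 'a::real_normed_vector \<Rightarrow> real) \<Rightarrow> (nat set \<Rightarrow> real) \<Rightarrow> nat \<Rightarrow>
    (nat \<Rightarrow> nat set) \<Rightarrow> (nat \<Rightarrow> real) \<Rightarrow> ereal" where
  "gamma_max f w N C \<alpha> =
     (INF (k, k')\<in>{(k, k'). k \<in> {1..N} \<and> k' \<in> {1..N} \<and> k \<noteq> k'}.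
        ereal (norm (argmin (cluster_fun f (C k)) - argmin (cluster_fun f (C k')))) /
        ereal (1 / \<alpha> k * out_weight w N C k + 1 / \<alpha> k' * out_weight w N C k'))"

definition gamma_min :: "(nat \<Rightarrow> 'a::real_inner \<Rightarrow> real) \<Rightarrow> (nat set \<Rightarrow> real) \<Rightarrow> nat \<Rightarrow>
    (nat \<Rightarrow> nat set) \<Rightarrow> (nat \<Rightarrow> real) \<Rightarrow> (nat \<Rightarrow> real) \<Rightarrow> ereal" where
  "gamma_min f w N C L \<alpha> =
     (SUP k\<in>{1..N}. SUP (i, j)\<in>{(i, j). i \<in> C k \<and> j \<in> C k \<and> i \<noteq> j}.
        ereal (norm (grad (f j) (argmin (cluster_fun f (C k))) -
                     grad (f i) (argmin (cluster_fun f (C k))))) /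
        ereal (real (card (C k)) * w {i, j} - mu w N C L \<alpha> k i j))"

definition gamma_coarse :: "(nat \<Rightarrow> 'a::real_inner \<Rightarrow> real) \<Rightarrow> (nat set \<Rightarrow> real) \<Rightarrow> nat \<Rightarrow>
    (nat \<Rightarrow> nat set) \<Rightarrow> 'a \<Rightarrow> ereal" where
  "gamma_coarse f w N C x =
     (SUP k\<in>{1..N}. ereal (norm (grad (cluster_fun f (C k)) x)) / ereal (out_weight w N C k))"

(* Every edge {i, j} is counted once, through its representation with i < j. *)
definition clustering_objective :: "nat \<Rightarrow> nat set set \<Rightarrow> (nat set \<Rightarrow> real) \<Rightarrow>
    (nat \<Rightarrow> 'a::real_normed_vector \<Rightarrow> real) \<Rightarrow> real \<Rightarrow> (nat \<Rightarrow> 'a) \<Rightarrow> real" where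
  "clustering_objective n E w f \<gamma> x =
     (\<Sum>i\<in>{1..n}. f i (x i)) +
     \<gamma> * (\<Sum>(i, j)\<in>{(i, j). i \<in> {1..n} \<and> j \<in> {1..n} \<and> i < j \<and> {i, j} \<in> E}.
            w {i, j} * norm (x i - x j))"

definition induced_partition :: "nat \<Rightarrow> (nat \<Rightarrow> 'a) \<Rightarrow> nat set set" where
  "induced_partition n x = {1..n} // {(i, j). i \<in> {1..n} \<and> j \<in> {1..n} \<and> x i = x j}"

definition perfectly_recovers :: "'v set set \<Rightarrow> 'v set set \<Rightarrow> bool" where
  "perfectly_recovers Q P \<longleftrightarrow> Q = P"

definition coarsening :: "'v set \<Rightarrow> 'v set set \<Rightarrow> 'v set set \<Rightarrow> bool" where
  "coarsening V Q P \<longleftrightarrow> partition_on V Q \<and> partition_on V P \<and> (\<forall>D\<in>Q. \<exists>I\<subseteq>P. D = \<Union>I)"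

definition nontrivial_coarsening :: "'v set \<Rightarrow> 'v set set \<Rightarrow> 'v set set \<Rightarrow> bool" where
  "nontrivial_coarsening V Q P \<longleftrightarrow> coarsening V Q P \<and> Q \<noteq> {V}"

end

theory Submission
  imports Defs
begin

text \<open>
  Restrict the objective to points that are constant on the clusters.  What remains is a problem of
  the same kind on the clusters themselves, with the functions \<open>cluster_fun f (C k)\<close> and the weights
  between clusters.  It has a minimizer \<open>y\<close>, because strong convexity makes it coercive
  (\<open>fused_has_minimizer\<close>).

  At \<open>y\<close> the gradient of a cluster balances the pull of the other clusters, so its norm is at most
  \<open>\<gamma>\<close> times the outgoing weight (\<open>fused_minimizer_grad_le\<close>).  By strong convexity the distance
  from \<open>y k\<close> to the centroid of its cluster is at most \<open>\<gamma> / \<alpha> k\<close> times that weight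
  (\<open>strongly_convex_dist_minimizer_le\<close>).

  The point that assigns \<open>y k\<close> to every vertex of cluster \<open>k\<close> is the only solution of the original
  problem once \<open>\<gamma>\<close> reaches the lower threshold (\<open>fused_lift_less\<close>).  To see this, split any
  competitor into its cluster means and its deviations from them.  The means cannot gain, by
  stationarity of \<open>y\<close> (\<open>fused_minimizer_first_order\<close>).  The deviations cannot gain either: two
  vertices of a cluster are driven apart by the difference of their gradients and of the pulls on
  them from outside, and the lower threshold says that the edge between them can withstand its
  share of this (\<open>cohesion_nonneg\<close>).  Strict convexity excludes ties.  Since all inequalities
  involved are tangent inequalities and one-sided limits, no subdifferential calculus and no dual
  certificate enters, although the norm fails to be differentiable wherever \<open>y\<close> fuses clusters.

  Both claims are now read off from \<open>y\<close>.  Clusters are never split, so the induced partition is a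
  coarsening.  Two clusters with equal \<open>y\<close> have centroids that are too close for \<open>\<gamma>\<close> to be below the
  upper threshold.  If all \<open>y\<close> coincide, then their common value minimizes the sum of all functions,
  and the gradient bound there contradicts the bound on \<open>\<gamma>\<close> in the second claim.
\<close>

section \<open>Gradients and convexity\<close>

lemma GDERIV_unique:
  assumes "GDERIV f x :> D" "GDERIV f x :> D'"
  shows "D = D'"
proof -
  have "(\<lambda>h. inner h D) = (\<lambda>h. inner h D')"
    using assms unfolding gderiv_def by (rule has_derivative_unique)
  then have "\<forall>h. inner h D = inner h D'"
    by meson
  then show ?thesis
    by (simp only: vector_eq_ldot)
qed

lemma grad_eqI:
  assumes "GDERIV f x :> D"
  shows "grad f x = D"
  unfolding grad_def using assms by (rule the_equality) (rule GDERIV_unique[OF _ assms])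

lemma GDERIV_grad:
  fixes f :: "'a::euclidean_space \<Rightarrow> real"
  assumes "f differentiable (at x)"
  shows "GDERIV f x :> grad f x"
proof -
  obtain F where F: "(f has_derivative F) (at x)"
    using assms by (auto simp: differentiable_def)
  have "linear F"
    using F has_derivative_linear by blast
  then have "F = (\<lambda>h. inner h (adjoint F 1))"
    using adjoint_works[of F _ 1] by auto
  then have "GDERIV f x :> adjoint F 1"
    using F unfolding gderiv_def by simp
  then show ?thesis
    by (simp only: grad_eqI)
qed

lemma GDERIV_sum:
  fixes f :: "'i \<Rightarrow> 'a::real_inner \<Rightarrow> real"
  assumes "\<And>i. i \<in> A \<Longrightarrow> GDERIV (f i) x :> D i"
  shows "GDERIV (\<lambda>z. \<Sum>i\<in>A. f i z) x :> (\<Sum>i\<in>A. D i)"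
  using assms unfolding gderiv_def inner_sum_right
  by (intro has_derivative_sum) auto

lemma smooth_fun_GDERIV:
  fixes f :: "'a::euclidean_space \<Rightarrow> real"
  assumes "smooth_fun L f"
  shows "GDERIV f x :> grad f x"
  using assms GDERIV_grad unfolding smooth_fun_def by blast

lemma GDERIV_along_line:
  assumes "GDERIV f x :> D"
  shows "((\<lambda>t. f (x + t *\<^sub>R h)) has_real_derivative inner D h) (at 0)"
proof -
  have "((\<lambda>t. x + t *\<^sub>R h) has_derivative (\<lambda>t. t *\<^sub>R h)) (at (0::real))"
    by (auto intro!: derivative_eq_intros)
  moreover have "(f has_derivative (\<lambda>h. inner h D)) (at (x + 0 *\<^sub>R h))"
    using assms unfolding gderiv_def by simp
  ultimately have "((\<lambda>t. f (x + t *\<^sub>R h)) has_derivative (\<lambda>t. inner (t *\<^sub>R h) D)) (at 0)"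
    by (rule has_derivative_compose)
  moreover have "(\<lambda>t. inner (t *\<^sub>R h) D) = (*) (inner D h)"
    by (auto simp: inner_commute mult.commute)
  ultimately show ?thesis
    by (simp add: has_field_derivative_def)
qed

text \<open>
  Stationarity and tangent inequalities alike result from passing to the limit in a one-sided
  difference quotient, which this lemma does once and for all.
\<close>

lemma DERIV_ge_slope:
  assumes D: "(\<phi> has_real_derivative c) (at 0)"
    and le: "\<And>t. 0 < t \<Longrightarrow> t < 1 \<Longrightarrow> \<phi> 0 + t * b \<le> \<phi> t"
  shows "b \<le> c"
proof -
  have "((\<lambda>t. (\<phi> t - \<phi> 0) / t) \<longlongrightarrow> c) (at 0)"
    using D unfolding has_field_derivative_iff by simp
  then have lim: "((\<lambda>t. (\<phi> t - \<phi> 0) / t) \<longlongrightarrow> c) (at_right 0)"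
    by (rule tendsto_mono[rotated]) (simp add: at_le)
  have "\<forall>\<^sub>F t::real in at_right 0. t \<in> {0<..<1}"
    by (rule eventually_at_right_real) simp
  then have "\<forall>\<^sub>F t in at_right 0. b \<le> (\<phi> t - \<phi> 0) / t"
  proof (rule eventually_mono)
    fix t :: real assume "t \<in> {0<..<1}"
    with le[of t] show "b \<le> (\<phi> t - \<phi> 0) / t"
      by (simp add: field_simps)
  qed
  with lim show ?thesis
    by (rule tendsto_lowerbound) simp
qed

lemma grad_eq_zero_at_minimum:
  assumes D: "GDERIV f x :> D" and min: "\<And>y. f x \<le> f y"
  shows "D = 0"
proof -
  have "0 \<le> inner D (- D)"
    by (rule DERIV_ge_slope[OF GDERIV_along_line[OF D]]) (use min in simp)
  then show ?thesis
    using inner_gt_zero_iff[of D] by (metis inner_minus_right neg_0_le_iff_le not_less)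
qed

lemma convex_on_ge_tangent:
  fixes f :: "'a::real_inner \<Rightarrow> real"
  assumes f: "convex_on UNIV f" and D: "GDERIV f x :> D"
  shows "f x + inner D (y - x) \<le> f y"
proof -
  have D': "((\<lambda>t. - f (x + t *\<^sub>R (y - x))) has_real_derivative - inner D (y - x)) (at 0)"
    by (intro DERIV_minus GDERIV_along_line D)
  have "f x - f y \<le> - inner D (y - x)"
  proof (rule DERIV_ge_slope[OF D'])
    fix t :: real assume t: "0 < t" "t < 1"
    have "f ((1 - t) *\<^sub>R x + t *\<^sub>R y) \<le> (1 - t) * f x + t * f y"
      using convex_onD[OF f] t by simp
    moreover have "(1 - t) *\<^sub>R x + t *\<^sub>R y = x + t *\<^sub>R (y - x)"
      by (simp add: algebra_simps)
    ultimately show "- f (x + 0 *\<^sub>R (y - x)) + t * (f x - f y) \<le> - f (x + t *\<^sub>R (y - x))"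
      by (simp add: algebra_simps)
  qed
  then show ?thesis by simp
qed

lemma strictly_convex_gt_tangent:
  fixes f :: "'a::real_inner \<Rightarrow> real"
  assumes f: "strictly_convex f" and D: "GDERIV f x :> D" and ne: "y \<noteq> x"
  shows "f x + inner D (y - x) < f y"
proof -
  have "convex_on UNIV f"
  proof (rule convex_onI)
    fix t :: real and u v :: 'a
    assume t: "0 < t" "t < 1"
    show "f ((1 - t) *\<^sub>R u + t *\<^sub>R v) \<le> (1 - t) * f u + t * f v"
    proof (cases "u = v")
      case True
      then show ?thesis by (simp add: algebra_simps)
    next
      case False
      with t f show ?thesis unfolding strictly_convex_def by (meson less_imp_le)
    qed
  qed simp
  \<comment> \<open>The plain tangent inequality at the midpoint, where strict convexity leaves a gap.\<close>
  then have "f x + inner D ((1/2) *\<^sub>R (y - x)) \<le> f (x + (1/2) *\<^sub>R (y - x))"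
    using convex_on_ge_tangent[OF _ D, of "x + (1/2) *\<^sub>R (y - x)"] by simp
  moreover have "f (x + t *\<^sub>R (y - x)) < (1 - t) * f x + t * f y" if "0 < t" "t < 1" for t
  proof -
    have "x + t *\<^sub>R (y - x) = (1 - t) *\<^sub>R x + t *\<^sub>R y"
      by (simp add: algebra_simps)
    with that ne f show ?thesis
      unfolding strictly_convex_def by metis
  qed
  from this[of "1/2"] have "f (x + (1/2) *\<^sub>R (y - x)) < (f x + f y) / 2"
    by simp
  ultimately show ?thesis
    by simp
qed

lemma strongly_convex_ge_quadratic:
  fixes f :: "'a::real_inner \<Rightarrow> real"
  assumes f: "strongly_convex \<alpha> f" and D: "GDERIV f x :> D"
  shows "f x + inner D (y - x) + \<alpha> / 2 * (norm (y - x))\<^sup>2 \<le> f y"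
proof -
  define g where "g = (\<lambda>z. f z - \<alpha> / 2 * (norm z)\<^sup>2)"
  have "convex_on UNIV g"
    using f unfolding strongly_convex_def g_def by simp
  moreover have "GDERIV g x :> D - \<alpha> *\<^sub>R x"
    using D unfolding g_def gderiv_def power2_norm_eq_inner
    by (auto intro!: derivative_eq_intros simp: inner_commute algebra_simps)
  ultimately have "g x + inner (D - \<alpha> *\<^sub>R x) (y - x) \<le> g y"
    by (rule convex_on_ge_tangent)
  then show ?thesis
    unfolding g_def power2_norm_eq_inner by (simp add: algebra_simps inner_commute)
qed

text \<open>
  This excludes empty clusters: the sum of no functions is zero.
\<close>

lemma not_strongly_convex_zero:
  "\<not> strongly_convex \<alpha> (\<lambda>x::'a::euclidean_space. 0)"
proof
  assume *: "strongly_convex \<alpha> (\<lambda>x::'a. 0)"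
  obtain b :: 'a where b: "norm b = 1"
    using SOME_Basis norm_Basis by blast
  have "GDERIV (\<lambda>x::'a. 0) 0 :> 0"
    by (rule GDERIV_const)
  from strongly_convex_ge_quadratic[OF * this, of b] have "\<alpha> \<le> 0"
    using b by simp
  then show False
    using * by (simp add: strongly_convex_def)
qed

lemma strongly_convex_has_minimizer:
  fixes f :: "'a::euclidean_space \<Rightarrow> real"
  assumes f: "strongly_convex \<alpha> f" and D: "\<And>x. GDERIV f x :> grad f x"
  shows "\<exists>z. \<forall>y. f z \<le> f y"
proof -
  \<comment> \<open>Outside this ball the quadratic lower bound at the origin exceeds \<open>f 0\<close>.\<close>
  let ?r = "2 * norm (grad f 0) / \<alpha>"
  have \<alpha>: "\<alpha> > 0"
    using f by (simp add: strongly_convex_def)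
  have cont: "continuous_on (cball 0 ?r) f"
    using D unfolding gderiv_def
    by (meson continuous_at_imp_continuous_on has_derivative_continuous)
  have "\<exists>z\<in>cball 0 ?r. \<forall>y\<in>cball 0 ?r. f z \<le> f y"
    using \<alpha> by (intro continuous_attains_inf cont) (auto simp: not_less)
  then obtain z where z: "\<And>y. y \<in> cball 0 ?r \<Longrightarrow> f z \<le> f y"
    by blast
  have "f z \<le> f y" for y
  proof (cases "y \<in> cball 0 ?r")
    case False
    then have r: "2 * norm (grad f 0) < \<alpha> * norm y"
      using \<alpha> by (simp add: field_simps)
    have "- inner (grad f 0) y \<le> norm (grad f 0) * norm y"
      using Cauchy_Schwarz_ineq2[of "grad f 0" y] by linarith
    also have "\<dots> \<le> \<alpha> / 2 * norm y * norm y"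
      using r by (intro mult_right_mono) auto
    finally have "f 0 \<le> f y"
      using strongly_convex_ge_quadratic[OF f D, of 0 y] by (simp add: power2_eq_square)
    moreover have "f z \<le> f 0"
      using z[of 0] \<alpha> by simp
    ultimately show ?thesis by simp
  qed (use z in blast)
  then show ?thesis by blast
qed

text \<open>
  Strong convexity turns a bound on the gradient into a bound on the distance to the minimizer;
  this is where the ratios of weights to convexity constants in the thresholds come from.
\<close>

lemma strongly_convex_dist_minimizer_le:
  fixes f :: "'a::real_inner \<Rightarrow> real"
  assumes f: "strongly_convex \<alpha> f" and D: "GDERIV f x :> D"
    and D0: "GDERIV f z :> 0"
  shows "\<alpha> * norm (x - z) \<le> norm D"
proof (cases "x = z")
  case False
  have "f z + \<alpha> / 2 * (norm (x - z))\<^sup>2 \<le> f x"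
    using strongly_convex_ge_quadratic[OF f D0, of x] by simp
  moreover have "f x + inner D (z - x) + \<alpha> / 2 * (norm (x - z))\<^sup>2 \<le> f z"
    using strongly_convex_ge_quadratic[OF f D, of z] by (simp add: norm_minus_commute)
  ultimately have "\<alpha> * (norm (x - z))\<^sup>2 \<le> inner D (x - z)"
    by (simp add: algebra_simps inner_diff_right)
  also have "\<dots> \<le> norm D * norm (x - z)"
    by (rule norm_cauchy_schwarz)
  finally show ?thesis
    using False by (simp add: power2_eq_square)
qed simp

lemma argmin_le:
  fixes g :: "'a \<Rightarrow> real"
  assumes "\<exists>z. \<forall>y. g z \<le> g y"
  shows "g (argmin g) \<le> g y"
proof -
  obtain z where "\<forall>y. g z \<le> g y"
    using assms by blast
  then have "is_arg_min g (\<lambda>_. True) z"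
    by (simp add: is_arg_min_linorder)
  then have "is_arg_min g (\<lambda>_. True) (argmin g)"
    unfolding argmin_def arg_min_def by (rule someI)
  then show ?thesis
    by (simp add: is_arg_min_linorder)
qed

section \<open>Minimization with a weighted fusion penalty\<close>

definition fusion_penalty :: "'i set \<Rightarrow> ('i \<Rightarrow> 'i \<Rightarrow> real) \<Rightarrow> ('i \<Rightarrow> 'a::real_normed_vector) \<Rightarrow> real" where
  "fusion_penalty I W y = (\<Sum>k\<in>I. \<Sum>l\<in>I. W k l * norm (y k - y l))"

text \<open>
  The penalty counts every unordered pair twice, which the factor one half makes up for.  Both the
  clustering objective on the vertices and its restriction to cluster-constant points, a problem
  on the clusters, have this form.
\<close>

definition fused_objective :: "'i set \<Rightarrow> ('i \<Rightarrow> 'a::real_normed_vector \<Rightarrow> real) \<Rightarrow>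
    ('i \<Rightarrow> 'i \<Rightarrow> real) \<Rightarrow> real \<Rightarrow> ('i \<Rightarrow> 'a) \<Rightarrow> real" where
  "fused_objective I h W \<gamma> y = (\<Sum>k\<in>I. h k (y k)) + \<gamma> / 2 * fusion_penalty I W y"

lemma fusion_penalty_nonneg:
  assumes "\<forall>k l. 0 \<le> W k l"
  shows "0 \<le> fusion_penalty I W y"
  unfolding fusion_penalty_def using assms by (intro sum_nonneg mult_nonneg_nonneg) auto

lemma fusion_penalty_convex:
  assumes W: "\<forall>k l. 0 \<le> W k l" and t: "0 \<le> t" "t \<le> 1"
  shows "fusion_penalty I W (\<lambda>k. y k + t *\<^sub>R (m k - y k))
    \<le> (1 - t) * fusion_penalty I W y + t * fusion_penalty I W m"
proof -
  have "W k l * norm ((y k + t *\<^sub>R (m k - y k)) - (y l + t *\<^sub>R (m l - y l)))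
      \<le> (1 - t) * (W k l * norm (y k - y l)) + t * (W k l * norm (m k - m l))" for k l
  proof -
    have "(y k + t *\<^sub>R (m k - y k)) - (y l + t *\<^sub>R (m l - y l))
        = (1 - t) *\<^sub>R (y k - y l) + t *\<^sub>R (m k - m l)"
      by (simp add: algebra_simps)
    then have "norm ((y k + t *\<^sub>R (m k - y k)) - (y l + t *\<^sub>R (m l - y l)))
        \<le> (1 - t) * norm (y k - y l) + t * norm (m k - m l)"
      using norm_triangle_ineq[of "(1 - t) *\<^sub>R (y k - y l)" "t *\<^sub>R (m k - m l)"] t by simp
    from mult_left_mono[OF this, of "W k l"] W show ?thesis
      by (simp add: algebra_simps)
  qed
  then show ?thesis
    unfolding fusion_penalty_def sum_distrib_left sum.distrib[symmetric]
    by (intro sum_mono) blast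
qed

text \<open>
  Quadratic growth confines the search to a product of closed balls, one per coordinate, which is
  compact in the product topology of the function space.
\<close>

lemma fused_has_minimizer:
  fixes h :: "'i \<Rightarrow> 'a::euclidean_space \<Rightarrow> real"
  assumes I: "finite I" and W: "\<forall>k l. 0 \<le> W k l" and \<gamma>: "0 \<le> \<gamma>"
    and cont: "\<And>k. k \<in> I \<Longrightarrow> continuous_on UNIV (h k)"
    and pos: "\<And>k. k \<in> I \<Longrightarrow> 0 < a k"
    and growth: "\<And>k z. k \<in> I \<Longrightarrow> h k (c k) + a k * (norm (z - c k))\<^sup>2 \<le> h k z"
  shows "\<exists>y. \<forall>z. fused_objective I h W \<gamma> y \<le> fused_objective I h W \<gamma> z"
proof -
  let ?F = "fused_objective I h W \<gamma>"
  define T where "T = ?F c - (\<Sum>k\<in>I. h k (c k))"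
  have pen: "0 \<le> \<gamma> / 2 * fusion_penalty I W z" for z :: "'i \<Rightarrow> 'a"
    using \<gamma> fusion_penalty_nonneg[OF W, of I z] by (intro mult_nonneg_nonneg) auto
  then have T: "0 \<le> T"
    unfolding T_def fused_objective_def by simp
  define B where "B = (\<Pi>\<^sub>E k\<in>UNIV. cball (c k) (sqrt (T / \<bar>a k\<bar>)))"
  have "compactin (product_topology (\<lambda>_. euclidean) UNIV) B"
    unfolding B_def by (simp add: compactin_PiE)
  then have "compact B"
    by (simp add: euclidean_product_topology)
  moreover have cB: "c \<in> B"
    unfolding B_def using T by auto
  moreover have "continuous_on B ?F"
    unfolding fused_objective_def fusion_penalty_def
    by (intro continuous_intros continuous_on_compose2[OF cont]
        continuous_on_subset[OF continuous_on_product_coordinates]) auto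
  ultimately obtain y where y: "\<And>z. z \<in> B \<Longrightarrow> ?F y \<le> ?F z"
    using continuous_attains_inf[of B ?F] by blast
  have "?F y \<le> ?F z" for z
  proof (cases "\<forall>k\<in>I. z k \<in> cball (c k) (sqrt (T / \<bar>a k\<bar>))")
    case True
    \<comment> \<open>Membership in \<open>B\<close> also constrains the coordinates outside the index set.\<close>
    define z' where "z' = (\<lambda>k. if k \<in> I then z k else c k)"
    have "z' \<in> B"
      using True T unfolding B_def z'_def by auto
    moreover have "?F z' = ?F z"
      unfolding fused_objective_def fusion_penalty_def z'_def by simp
    ultimately show ?thesis
      using y by metis
  next
    case False
    then obtain k where k: "k \<in> I" "sqrt (T / a k) < norm (z k - c k)"
      using pos by (auto simp: dist_norm norm_minus_commute not_le abs_of_pos)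
    have "(sqrt (T / a k))\<^sup>2 < (norm (z k - c k))\<^sup>2"
      using k T pos[OF k(1)] by (intro power_strict_mono) auto
    then have "T < a k * (norm (z k - c k))\<^sup>2"
      using T pos[OF k(1)] by (simp add: field_simps)
    also have "\<dots> \<le> (\<Sum>k\<in>I. a k * (norm (z k - c k))\<^sup>2)"
      using k(1) pos by (intro member_le_sum I) (auto simp: less_imp_le)
    also have "\<dots> \<le> (\<Sum>k\<in>I. h k (z k) - h k (c k))"
      using growth by (intro sum_mono) (simp add: algebra_simps)
    finally have "?F c \<le> (\<Sum>k\<in>I. h k (z k))"
      unfolding T_def by (simp add: sum_subtractf)
    also have "\<dots> \<le> ?F z"
      unfolding fused_objective_def using pen by simp
    finally show ?thesis
      using y[OF cB] by simp
  qed
  then show ?thesis by blast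
qed

text \<open>
  Moving a fraction \<open>t\<close> of the way from a minimizer \<open>y\<close> towards any \<open>m\<close>, the penalty grows at
  most linearly in \<open>t\<close> by convexity, while the smooth part may be linearized as \<open>t\<close> tends to zero.
  The outcome expresses stationarity without subgradients of the norm at the pairs that \<open>y\<close> fuses.
\<close>

lemma fused_minimizer_first_order:
  fixes h :: "'i \<Rightarrow> 'a::real_inner \<Rightarrow> real"
  assumes W: "\<forall>k l. 0 \<le> W k l" and \<gamma>: "0 \<le> \<gamma>"
    and min: "\<And>z. fused_objective I h W \<gamma> y \<le> fused_objective I h W \<gamma> z"
    and D: "\<And>k. k \<in> I \<Longrightarrow> GDERIV (h k) (y k) :> D k"
  shows "\<gamma> / 2 * fusion_penalty I W y
    \<le> (\<Sum>k\<in>I. inner (D k) (m k - y k)) + \<gamma> / 2 * fusion_penalty I W m"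
proof -
  define \<phi> where "\<phi> = (\<lambda>t. \<Sum>k\<in>I. h k (y k + t *\<^sub>R (m k - y k)))"
  have "(\<phi> has_real_derivative (\<Sum>k\<in>I. inner (D k) (m k - y k))) (at 0)"
    unfolding \<phi>_def by (intro DERIV_sum GDERIV_along_line D)
  then have "\<gamma> / 2 * fusion_penalty I W y - \<gamma> / 2 * fusion_penalty I W m
      \<le> (\<Sum>k\<in>I. inner (D k) (m k - y k))"
  proof (rule DERIV_ge_slope)
    fix t :: real assume t: "0 < t" "t < 1"
    have "\<phi> 0 + \<gamma> / 2 * fusion_penalty I W y
        \<le> \<phi> t + \<gamma> / 2 * fusion_penalty I W (\<lambda>k. y k + t *\<^sub>R (m k - y k))"
      using min[of "\<lambda>k. y k + t *\<^sub>R (m k - y k)"] unfolding \<phi>_def fused_objective_def by simp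
    also have "\<dots> \<le> \<phi> t + \<gamma> / 2 * ((1 - t) * fusion_penalty I W y + t * fusion_penalty I W m)"
      using fusion_penalty_convex[OF W, of t I y m] t \<gamma> by (simp add: mult_left_mono)
    finally show "\<phi> 0 + t * (\<gamma> / 2 * fusion_penalty I W y - \<gamma> / 2 * fusion_penalty I W m) \<le> \<phi> t"
      by (simp add: algebra_simps)
  qed
  then show ?thesis by simp
qed

text \<open>
  Half the penalty is Lipschitz in each single coordinate, with the total weight of its pairs as
  the constant; perturbing that coordinate along the negative gradient gives the bound.
\<close>

lemma fused_minimizer_grad_le:
  fixes h :: "'i \<Rightarrow> 'a::real_inner \<Rightarrow> real"
  assumes I: "finite I" and W: "\<forall>k l. 0 \<le> W k l" and sym: "\<And>k l. W k l = W l k"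
    and \<gamma>: "0 \<le> \<gamma>"
    and min: "\<And>z. fused_objective I h W \<gamma> y \<le> fused_objective I h W \<gamma> z"
    and D: "\<And>k. k \<in> I \<Longrightarrow> GDERIV (h k) (y k) :> D k" and k: "k \<in> I"
  shows "norm (D k) \<le> \<gamma> * (\<Sum>l\<in>I - {k}. W k l)"
proof -
  define m where "m = y(k := y k - D k)"
  have "norm (m p - m q)
      \<le> norm (y p - y q) + ((if p = k then if q = k then 0 else norm (D k) else 0)
                            + (if q = k then if p = k then 0 else norm (D k) else 0))" for p q
    using norm_triangle_ineq4[of "y k - y q" "D k"] norm_triangle_ineq[of "y p - y k" "D k"]
    unfolding m_def by (simp add: algebra_simps)
  from mult_left_mono[OF this] W
  have "fusion_penalty I W m \<le> (\<Sum>p\<in>I. \<Sum>q\<in>I. W p q * norm (y p - y q)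
      + ((if p = k then if q = k then 0 else W p q * norm (D k) else 0)
         + (if q = k then if p = k then 0 else W p q * norm (D k) else 0)))"
    unfolding fusion_penalty_def
    by (intro sum_mono) (smt (verit, best) distrib_left mult_zero_right)
  also have "\<dots> = fusion_penalty I W y
      + ((\<Sum>q\<in>I. if q = k then 0 else W k q * norm (D k))
         + (\<Sum>p\<in>I. if p = k then 0 else W p k * norm (D k)))"
  proof -
    have "(\<Sum>p\<in>I. \<Sum>q\<in>I. if p = k then if q = k then 0 else W p q * norm (D k) else 0)
        = (\<Sum>p\<in>I. if p = k then \<Sum>q\<in>I. if q = k then 0 else W p q * norm (D k) else 0)"
      by (intro sum.cong) auto
    then show ?thesis
      using I k by (simp add: fusion_penalty_def sum.distrib)
  qed
  also have "\<dots> = fusion_penalty I W y + 2 * (norm (D k) * (\<Sum>l\<in>I - {k}. W k l))"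
  proof -
    have "(\<Sum>q\<in>I. if q = k then 0 else W k q * norm (D k)) = norm (D k) * (\<Sum>l\<in>I - {k}. W k l)"
      using I k by (simp add: sum.remove[of I k] sum_distrib_left mult.commute)
    moreover have "(\<Sum>p\<in>I. if p = k then 0 else W p k * norm (D k))
        = (\<Sum>q\<in>I. if q = k then 0 else W k q * norm (D k))"
      by (intro sum.cong refl) (simp add: sym)
    ultimately show ?thesis by simp
  qed
  finally have pen: "fusion_penalty I W m
      \<le> fusion_penalty I W y + 2 * (norm (D k) * (\<Sum>l\<in>I - {k}. W k l))" .
  have "(\<Sum>l\<in>I. inner (D l) (m l - y l)) = (\<Sum>l\<in>I. if l = k then - (norm (D k))\<^sup>2 else 0)"
    by (intro sum.cong) (auto simp: m_def power2_norm_eq_inner)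
  then have "(\<Sum>l\<in>I. inner (D l) (m l - y l)) = - (norm (D k))\<^sup>2"
    using I k by simp
  moreover have "\<gamma> / 2 * fusion_penalty I W y
      \<le> (\<Sum>l\<in>I. inner (D l) (m l - y l)) + \<gamma> / 2 * fusion_penalty I W m"
    by (rule fused_minimizer_first_order[OF W \<gamma> min D])
  moreover have "\<gamma> / 2 * fusion_penalty I W m
      \<le> \<gamma> / 2 * (fusion_penalty I W y + 2 * (norm (D k) * (\<Sum>l\<in>I - {k}. W k l)))"
    using pen \<gamma> by (intro mult_left_mono) auto
  ultimately have "norm (D k) * norm (D k) \<le> norm (D k) * (\<gamma> * (\<Sum>l\<in>I - {k}. W k l))"
    by (simp add: algebra_simps power2_eq_square)
  then show ?thesis
    using W \<gamma> by (cases "D k = 0") (auto simp: sum_nonneg)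
qed

section \<open>Lifting a cluster-level minimizer to the vertices\<close>

lemma sum_inner_diff_diff:
  fixes g d :: "'v \<Rightarrow> 'a::real_inner"
  shows "(\<Sum>i\<in>A. \<Sum>j\<in>A. inner (g i - g j) (d i - d j))
    = 2 * (real (card A) * (\<Sum>i\<in>A. inner (g i) (d i)) - inner (\<Sum>i\<in>A. g i) (\<Sum>i\<in>A. d i))"
proof -
  have "(\<Sum>i\<in>A. \<Sum>j\<in>A. inner (g i - g j) (d i - d j))
      = (\<Sum>i\<in>A. \<Sum>j\<in>A. inner (g i) (d i)) + (\<Sum>i\<in>A. \<Sum>j\<in>A. inner (g j) (d j))
        - (\<Sum>i\<in>A. \<Sum>j\<in>A. inner (g i) (d j)) - (\<Sum>i\<in>A. \<Sum>j\<in>A. inner (g j) (d i))"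
    by (simp add: inner_diff_left inner_diff_right sum.distrib sum_subtractf)
  moreover have "(\<Sum>i\<in>A. \<Sum>j\<in>A. inner (g j) (d i)) = (\<Sum>i\<in>A. \<Sum>j\<in>A. inner (g i) (d j))"
    by (rule sum.swap)
  moreover have "(\<Sum>i\<in>A. \<Sum>j\<in>A. inner (g i) (d j)) = inner (\<Sum>i\<in>A. g i) (\<Sum>i\<in>A. d i)"
    unfolding inner_sum_left inner_sum_right by (rule sum.swap)
  ultimately show ?thesis
    by (simp add: sum_distrib_left)
qed

text \<open>
  Within one cluster the forces \<open>g\<close> pull the vertices apart, the edges hold them together.  As the
  deviations \<open>d\<close> sum to zero, the work of the forces depends only on the differences of \<open>g\<close> and of
  \<open>d\<close>, and every pair can be charged to its own edge.
\<close>

lemma cohesion_nonneg: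
  fixes g d :: "'v \<Rightarrow> 'a::real_inner"
  assumes d: "(\<Sum>i\<in>A. d i) = 0"
    and g: "\<And>i j. i \<in> A \<Longrightarrow> j \<in> A \<Longrightarrow> i \<noteq> j \<Longrightarrow> norm (g i - g j) \<le> \<gamma> * (real (card A) * a i j)"
  shows "0 \<le> (\<Sum>i\<in>A. inner (g i) (d i)) + \<gamma> / 2 * (\<Sum>i\<in>A. \<Sum>j\<in>A. a i j * norm (d i - d j))"
proof (cases "card A = 0")
  case True
  then show ?thesis by (auto simp: card_eq_0_iff)
next
  case False
  have pair: "- (\<gamma> * (real (card A) * a i j) * norm (d i - d j)) \<le> inner (g i - g j) (d i - d j)"
    if "i \<in> A" "j \<in> A" for i j
  proof (cases "i = j")
    case False
    have "- inner (g i - g j) (d i - d j) \<le> norm (g i - g j) * norm (d i - d j)"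
      using Cauchy_Schwarz_ineq2[of "g i - g j" "d i - d j"] by linarith
    also have "\<dots> \<le> \<gamma> * (real (card A) * a i j) * norm (d i - d j)"
      using g that False by (intro mult_right_mono) auto
    finally show ?thesis by simp
  qed simp
  have "- (real (card A) * (\<gamma> * (\<Sum>i\<in>A. \<Sum>j\<in>A. a i j * norm (d i - d j))))
      = (\<Sum>i\<in>A. \<Sum>j\<in>A. - (\<gamma> * (real (card A) * a i j) * norm (d i - d j)))"
    by (simp add: sum_distrib_left sum_negf mult_ac)
  also have "\<dots> \<le> (\<Sum>i\<in>A. \<Sum>j\<in>A. inner (g i - g j) (d i - d j))"
    by (intro sum_mono pair)
  also have "\<dots> = real (card A) * (2 * (\<Sum>i\<in>A. inner (g i) (d i)))"
    unfolding sum_inner_diff_diff d by simp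
  finally have "0 \<le> real (card A) * (2 * (\<Sum>i\<in>A. inner (g i) (d i))
      + \<gamma> * (\<Sum>i\<in>A. \<Sum>j\<in>A. a i j * norm (d i - d j)))"
    by (simp add: algebra_simps)
  then have "0 \<le> 2 * (\<Sum>i\<in>A. inner (g i) (d i)) + \<gamma> * (\<Sum>i\<in>A. \<Sum>j\<in>A. a i j * norm (d i - d j))"
    using False by (simp add: zero_le_mult_iff)
  then show ?thesis by simp
qed

lemma norm_add_ge_sgn:
  fixes u v :: "'a::real_inner"
  shows "norm u + inner (sgn u) v \<le> norm (u + v)"
proof (cases "u = 0")
  case False
  have "norm u + inner (sgn u) v = inner (sgn u) (u + v)"
    using False by (simp add: sgn_div_norm inner_add_right dot_square_norm power2_eq_square)
  also have "\<dots> \<le> norm (sgn u) * norm (u + v)"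
    by (rule norm_cauchy_schwarz)
  finally show ?thesis
    using False by (simp add: norm_sgn)
qed simp

text \<open>
  A partition enters as a map \<open>\<kappa>\<close> from vertices to cluster labels, so that its clusters are
  disjoint by construction.
\<close>

definition fibre :: "'v set \<Rightarrow> ('v \<Rightarrow> 'i) \<Rightarrow> 'i \<Rightarrow> 'v set" where
  "fibre V \<kappa> k = {i \<in> V. \<kappa> i = k}"

definition cluster_weight :: "'v set \<Rightarrow> ('v \<Rightarrow> 'i) \<Rightarrow> ('v \<Rightarrow> 'v \<Rightarrow> real) \<Rightarrow> 'i \<Rightarrow> 'i \<Rightarrow> real" where
  "cluster_weight V \<kappa> a k l = (\<Sum>i\<in>fibre V \<kappa> k. \<Sum>j\<in>fibre V \<kappa> l. a i j)"

lemma sum_fibres: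
  assumes "finite V" "finite I" "\<kappa> ` V \<subseteq> I"
  shows "(\<Sum>i\<in>V. \<phi> i) = (\<Sum>k\<in>I. \<Sum>i\<in>fibre V \<kappa> k. \<phi> i)"
  unfolding fibre_def using sum.group[OF assms, of \<phi>] by simp

lemma sum_fibres_weighted:
  assumes "finite V" "finite I" "\<kappa> ` V \<subseteq> I"
  shows "(\<Sum>i\<in>V. \<Sum>j\<in>V. a i j * q (\<kappa> i) (\<kappa> j)) = (\<Sum>k\<in>I. \<Sum>l\<in>I. cluster_weight V \<kappa> a k l * q k l)"
proof -
  have "(\<Sum>i\<in>V. \<Sum>j\<in>V. a i j * q (\<kappa> i) (\<kappa> j))
      = (\<Sum>k\<in>I. \<Sum>i\<in>fibre V \<kappa> k. \<Sum>l\<in>I. \<Sum>j\<in>fibre V \<kappa> l. a i j * q (\<kappa> i) (\<kappa> j))"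
    unfolding sum_fibres[OF assms] ..
  also have "\<dots> = (\<Sum>k\<in>I. \<Sum>l\<in>I. \<Sum>i\<in>fibre V \<kappa> k. \<Sum>j\<in>fibre V \<kappa> l. a i j * q (\<kappa> i) (\<kappa> j))"
    by (intro sum.cong refl sum.swap)
  also have "\<dots> = (\<Sum>k\<in>I. \<Sum>l\<in>I. cluster_weight V \<kappa> a k l * q k l)"
    unfolding cluster_weight_def sum_distrib_right
    by (intro sum.cong refl) (auto simp: fibre_def)
  finally show ?thesis .
qed

text \<open>
  Think of \<open>m\<close> as the cluster means of \<open>x\<close> and of \<open>d\<close> as the deviations from them.  Across clusters
  the norm is bounded below by an affine function that touches it at the difference of the means.
  The slopes \<open>s\<close> are antisymmetric in the two clusters, so that after summation they act on the
  deviations as one force per vertex.  Within a cluster the means cancel.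
\<close>

lemma fusion_penalty_ge_means_plus_deviations:
  fixes x d :: "'v \<Rightarrow> 'a::real_inner" and m :: "'i \<Rightarrow> 'a"
  assumes V: "finite V" "finite I" "\<kappa> ` V \<subseteq> I"
    and a: "\<forall>i j. 0 \<le> a i j" and sym: "\<And>i j. a i j = a j i"
    and x: "\<And>i. i \<in> V \<Longrightarrow> x i = m (\<kappa> i) + d i"
  defines "s \<equiv> \<lambda>k l. sgn (m k - m l)"
  shows "fusion_penalty I (cluster_weight V \<kappa> a) m
      + 2 * (\<Sum>i\<in>V. inner (\<Sum>j\<in>V. a i j *\<^sub>R s (\<kappa> i) (\<kappa> j)) (d i))
      + (\<Sum>k\<in>I. \<Sum>i\<in>fibre V \<kappa> k. \<Sum>j\<in>fibre V \<kappa> k. a i j * norm (d i - d j))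
    \<le> fusion_penalty V a x"
proof -
  have anti: "s k l = - s l k" for k l
    unfolding s_def by (metis minus_diff_eq sgn_minus)
  have "norm (m (\<kappa> i) - m (\<kappa> j)) + inner (s (\<kappa> i) (\<kappa> j)) (d i - d j)
      + (if \<kappa> j = \<kappa> i then norm (d i - d j) else 0) \<le> norm (x i - x j)" if "i \<in> V" "j \<in> V" for i j
    using that x norm_add_ge_sgn[of "m (\<kappa> i) - m (\<kappa> j)" "d i - d j"]
    by (auto simp: s_def algebra_simps)
  from mult_left_mono[OF this] a
  have "(\<Sum>i\<in>V. \<Sum>j\<in>V. a i j * (norm (m (\<kappa> i) - m (\<kappa> j)) + inner (s (\<kappa> i) (\<kappa> j)) (d i - d j)
      + (if \<kappa> j = \<kappa> i then norm (d i - d j) else 0))) \<le> fusion_penalty V a x"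
    unfolding fusion_penalty_def by (intro sum_mono) blast
  moreover have "(\<Sum>i\<in>V. \<Sum>j\<in>V. a i j * norm (m (\<kappa> i) - m (\<kappa> j)))
      = fusion_penalty I (cluster_weight V \<kappa> a) m"
    unfolding fusion_penalty_def
    using sum_fibres_weighted[OF V, of a "\<lambda>k l. norm (m k - m l)"] by simp
  moreover have "(\<Sum>i\<in>V. \<Sum>j\<in>V. a i j * inner (s (\<kappa> i) (\<kappa> j)) (d i - d j))
      = 2 * (\<Sum>i\<in>V. inner (\<Sum>j\<in>V. a i j *\<^sub>R s (\<kappa> i) (\<kappa> j)) (d i))"
  proof -
    have "(\<Sum>i\<in>V. \<Sum>j\<in>V. a i j * inner (s (\<kappa> i) (\<kappa> j)) (d j))
        = (\<Sum>i\<in>V. \<Sum>j\<in>V. a j i * inner (s (\<kappa> j) (\<kappa> i)) (d i))"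
      by (rule sum.swap)
    also have "\<dots> = (\<Sum>i\<in>V. \<Sum>j\<in>V. - (a i j * inner (s (\<kappa> i) (\<kappa> j)) (d i)))"
    proof (intro sum.cong refl)
      fix i j
      show "a j i * inner (s (\<kappa> j) (\<kappa> i)) (d i) = - (a i j * inner (s (\<kappa> i) (\<kappa> j)) (d i))"
        using sym[of j i] anti[of "\<kappa> j" "\<kappa> i"] by simp
    qed
    finally show ?thesis
      by (simp add: inner_diff_right inner_sum_left right_diff_distrib sum_subtractf sum_negf)
  qed
  moreover have "(\<Sum>i\<in>V. \<Sum>j\<in>V. a i j * (if \<kappa> j = \<kappa> i then norm (d i - d j) else 0))
      = (\<Sum>k\<in>I. \<Sum>i\<in>fibre V \<kappa> k. \<Sum>j\<in>fibre V \<kappa> k. a i j * norm (d i - d j))"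
  proof -
    have "(\<Sum>j\<in>V. a i j * (if \<kappa> j = \<kappa> i then norm (d i - d j) else 0))
        = (\<Sum>j\<in>fibre V \<kappa> (\<kappa> i). a i j * norm (d i - d j))" for i
      unfolding fibre_def sum.inter_filter[OF V(1)] by (intro sum.cong refl) simp
    then have "(\<Sum>i\<in>V. \<Sum>j\<in>V. a i j * (if \<kappa> j = \<kappa> i then norm (d i - d j) else 0))
        = (\<Sum>k\<in>I. \<Sum>i\<in>fibre V \<kappa> k. \<Sum>j\<in>fibre V \<kappa> (\<kappa> i). a i j * norm (d i - d j))"
      using sum_fibres[OF V, of "\<lambda>i. \<Sum>j\<in>fibre V \<kappa> (\<kappa> i). a i j * norm (d i - d j)"] by simp
    also have "\<dots> = (\<Sum>k\<in>I. \<Sum>i\<in>fibre V \<kappa> k. \<Sum>j\<in>fibre V \<kappa> k. a i j * norm (d i - d j))"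
      by (intro sum.cong refl) (auto simp: fibre_def)
    finally show ?thesis .
  qed
  ultimately show ?thesis
    by (simp add: distrib_left sum.distrib)
qed

text \<open>
  For a candidate \<open>x\<close> with cluster means \<open>m\<close>, linearize every \<open>h i\<close> at the
  lifted point and split the displacement of \<open>x\<close> into its means and its deviations.  The means
  contribute nothing negative since \<open>y\<close> is stationary on the level of clusters; the deviations
  contribute nothing negative by cohesion within the clusters.  For the latter, the force on a
  vertex combines its gradient with the pull of the other clusters, and the pull differs between
  two vertices of a cluster by no more than their weights towards the other clusters do.
\<close>

lemma fused_lift_less:
  fixes h :: "'v \<Rightarrow> 'a::real_inner \<Rightarrow> real" and x :: "'v \<Rightarrow> 'a" and y :: "'i \<Rightarrow> 'a"
  assumes V: "finite V" "finite I" "\<kappa> ` V \<subseteq> I"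
    and a: "\<forall>i j. 0 \<le> a i j" and sym: "\<And>i j. a i j = a j i" and \<gamma>: "0 \<le> \<gamma>"
    and stationary: "\<And>m. \<gamma> / 2 * fusion_penalty I (cluster_weight V \<kappa> a) y
      \<le> (\<Sum>k\<in>I. inner (\<Sum>i\<in>fibre V \<kappa> k. D i) (m k - y k))
        + \<gamma> / 2 * fusion_penalty I (cluster_weight V \<kappa> a) m"
    and tangent: "\<And>i z. i \<in> V \<Longrightarrow> z \<noteq> y (\<kappa> i) \<Longrightarrow>
      h i (y (\<kappa> i)) + inner (D i) (z - y (\<kappa> i)) < h i z"
    and spread: "\<And>i j. i \<in> V \<Longrightarrow> j \<in> V \<Longrightarrow> \<kappa> i = \<kappa> j \<Longrightarrow> i \<noteq> j \<Longrightarrow>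
      norm (D i - D j) + \<gamma> * (\<Sum>l\<in>I - {\<kappa> i}.
          \<bar>(\<Sum>v\<in>fibre V \<kappa> l. a i v) - (\<Sum>v\<in>fibre V \<kappa> l. a j v)\<bar>)
        \<le> \<gamma> * (real (card (fibre V \<kappa> (\<kappa> i))) * a i j)"
    and ne: "\<exists>i\<in>V. x i \<noteq> y (\<kappa> i)"
  shows "fused_objective V h a \<gamma> (\<lambda>i. y (\<kappa> i)) < fused_objective V h a \<gamma> x"
proof -
  let ?W = "cluster_weight V \<kappa> a"
  define m where "m = (\<lambda>k. (1 / real (card (fibre V \<kappa> k))) *\<^sub>R (\<Sum>i\<in>fibre V \<kappa> k. x i))"
  define d where "d = (\<lambda>i. x i - m (\<kappa> i))"
  define s where "s = (\<lambda>k l. sgn (m k - m l))"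
  define p where "p = (\<lambda>i. \<Sum>j\<in>V. a i j *\<^sub>R s (\<kappa> i) (\<kappa> j))"
  define g where "g = (\<lambda>i. D i + \<gamma> *\<^sub>R p i)"
  define coh where "coh = (\<lambda>k. \<Sum>i\<in>fibre V \<kappa> k. \<Sum>j\<in>fibre V \<kappa> k. a i j * norm (d i - d j))"
  have fin: "finite (fibre V \<kappa> k)" for k
    unfolding fibre_def using V(1) by simp
  have p_eq: "p i = (\<Sum>l\<in>I - {\<kappa> i}. (\<Sum>v\<in>fibre V \<kappa> l. a i v) *\<^sub>R s (\<kappa> i) l)" if "i \<in> V" for i
  proof -
    have "p i = (\<Sum>l\<in>I. (\<Sum>v\<in>fibre V \<kappa> l. a i v) *\<^sub>R s (\<kappa> i) l)"
      unfolding p_def sum_fibres[OF V] scaleR_sum_left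
      by (intro sum.cong refl) (auto simp: fibre_def)
    moreover have "\<kappa> i \<in> I" "s (\<kappa> i) (\<kappa> i) = 0"
      using that V(3) by (auto simp: s_def)
    ultimately show ?thesis
      using V(2) by (simp add: sum.remove)
  qed
  have norm_s: "norm (s k l) \<le> 1" for k l
    unfolding s_def by (simp add: norm_sgn)

  have "0 \<le> (\<Sum>i\<in>fibre V \<kappa> k. inner (g i) (d i)) + \<gamma> / 2 * coh k" for k
    unfolding coh_def
  proof (rule cohesion_nonneg)
    show "(\<Sum>i\<in>fibre V \<kappa> k. d i) = 0"
    proof (cases "fibre V \<kappa> k = {}")
      case False
      have "(\<Sum>i\<in>fibre V \<kappa> k. d i) = (\<Sum>i\<in>fibre V \<kappa> k. x i - m k)"
        by (intro sum.cong refl) (auto simp: d_def fibre_def)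
      also have "\<dots> = (\<Sum>i\<in>fibre V \<kappa> k. x i) - real (card (fibre V \<kappa> k)) *\<^sub>R m k"
        by (simp add: sum_subtractf sum_constant_scaleR)
      finally show ?thesis
        using False fin[of k] by (simp add: m_def)
    qed simp
  next
    fix i j assume "i \<in> fibre V \<kappa> k" "j \<in> fibre V \<kappa> k" and ij: "i \<noteq> j"
    then have i: "i \<in> V" "\<kappa> i = k" and j: "j \<in> V" "\<kappa> j = k"
      by (auto simp: fibre_def)
    let ?a = "\<lambda>i l. \<Sum>v\<in>fibre V \<kappa> l. a i v"
    have "norm (p i - p j) = norm (\<Sum>l\<in>I - {k}. (?a i l - ?a j l) *\<^sub>R s k l)"
      using p_eq[OF i(1)] p_eq[OF j(1)] i(2) j(2) by (simp add: scaleR_left_diff_distrib sum_subtractf)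
    also have "\<dots> \<le> (\<Sum>l\<in>I - {k}. \<bar>?a i l - ?a j l\<bar>)"
      by (rule sum_norm_le) (simp add: mult_left_le norm_s)
    finally have "norm (p i - p j) \<le> (\<Sum>l\<in>I - {k}. \<bar>?a i l - ?a j l\<bar>)" .
    then have "\<gamma> * norm (p i - p j) \<le> \<gamma> * (\<Sum>l\<in>I - {k}. \<bar>?a i l - ?a j l\<bar>)"
      using \<gamma> by (rule mult_left_mono)
    moreover have "norm (g i - g j) \<le> norm (D i - D j) + \<gamma> * norm (p i - p j)"
    proof -
      have "g i - g j = (D i - D j) + \<gamma> *\<^sub>R (p i - p j)"
        by (simp add: g_def algebra_simps)
      then show ?thesis
        using norm_triangle_ineq[of "D i - D j" "\<gamma> *\<^sub>R (p i - p j)"] \<gamma> by simp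
    qed
    ultimately show "norm (g i - g j) \<le> \<gamma> * (real (card (fibre V \<kappa> k)) * a i j)"
      using spread[of i j] i j ij by simp
  qed
  then have "0 \<le> (\<Sum>k\<in>I. (\<Sum>i\<in>fibre V \<kappa> k. inner (g i) (d i)) + \<gamma> / 2 * coh k)"
    by (intro sum_nonneg) blast
  then have dev: "0 \<le> (\<Sum>i\<in>V. inner (g i) (d i)) + \<gamma> / 2 * (\<Sum>k\<in>I. coh k)"
    unfolding sum_fibres[OF V] by (simp add: sum.distrib sum_distrib_left)

  have "fusion_penalty I ?W m + 2 * (\<Sum>i\<in>V. inner (p i) (d i)) + (\<Sum>k\<in>I. coh k)
      \<le> fusion_penalty V a x"
    unfolding p_def s_def coh_def
    by (rule fusion_penalty_ge_means_plus_deviations[OF V a sym]) (simp add: d_def)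
  from mult_left_mono[OF this, of "\<gamma> / 2"] \<gamma>
  have pen: "\<gamma> / 2 * fusion_penalty I ?W m + \<gamma> * (\<Sum>i\<in>V. inner (p i) (d i)) + \<gamma> / 2 * (\<Sum>k\<in>I. coh k)
      \<le> \<gamma> / 2 * fusion_penalty V a x"
    by (simp add: algebra_simps)

  have "(\<Sum>i\<in>V. h i (y (\<kappa> i)) + inner (D i) (x i - y (\<kappa> i))) < (\<Sum>i\<in>V. h i (x i))"
  proof (rule sum_strict_mono_ex1[OF V(1)])
    show "\<forall>i\<in>V. h i (y (\<kappa> i)) + inner (D i) (x i - y (\<kappa> i)) \<le> h i (x i)"
    proof
      fix i assume "i \<in> V"
      then show "h i (y (\<kappa> i)) + inner (D i) (x i - y (\<kappa> i)) \<le> h i (x i)"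
        using tangent[of i "x i"] by (cases "x i = y (\<kappa> i)") auto
    qed
    show "\<exists>i\<in>V. h i (y (\<kappa> i)) + inner (D i) (x i - y (\<kappa> i)) < h i (x i)"
      using ne tangent by blast
  qed
  moreover have "(\<Sum>i\<in>V. inner (D i) (x i - y (\<kappa> i)))
      = (\<Sum>k\<in>I. inner (\<Sum>i\<in>fibre V \<kappa> k. D i) (m k - y k)) + (\<Sum>i\<in>V. inner (D i) (d i))"
  proof -
    have "(\<Sum>i\<in>V. inner (D i) (x i - y (\<kappa> i)))
        = (\<Sum>i\<in>V. inner (D i) (m (\<kappa> i) - y (\<kappa> i))) + (\<Sum>i\<in>V. inner (D i) (d i))"
      unfolding sum.distrib[symmetric] by (simp add: d_def flip: inner_add_right)
    moreover have "(\<Sum>i\<in>V. inner (D i) (m (\<kappa> i) - y (\<kappa> i)))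
        = (\<Sum>k\<in>I. inner (\<Sum>i\<in>fibre V \<kappa> k. D i) (m k - y k))"
      unfolding sum_fibres[OF V] inner_sum_left
      by (intro sum.cong refl) (auto simp: fibre_def)
    ultimately show ?thesis by simp
  qed
  moreover have "(\<Sum>i\<in>V. inner (g i) (d i))
      = (\<Sum>i\<in>V. inner (D i) (d i)) + \<gamma> * (\<Sum>i\<in>V. inner (p i) (d i))"
    by (simp add: g_def inner_add_left sum.distrib sum_distrib_left)
  moreover have "fused_objective V h a \<gamma> (\<lambda>i. y (\<kappa> i))
      = (\<Sum>i\<in>V. h i (y (\<kappa> i))) + \<gamma> / 2 * fusion_penalty I ?W y"
    unfolding fused_objective_def fusion_penalty_def
    using sum_fibres_weighted[OF V, of a "\<lambda>k l. norm (y k - y l)"] by simp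
  ultimately show ?thesis
    using stationary[of m] pen dev unfolding fused_objective_def sum.distrib by linarith
qed

section \<open>The clustering objective\<close>

lemma sum_symmetric_pairs:
  fixes \<phi> :: "nat \<Rightarrow> nat \<Rightarrow> real"
  assumes V: "finite V" and sym: "\<And>i j. \<phi> i j = \<phi> j i" and diag: "\<And>i. \<phi> i i = 0"
  shows "(\<Sum>i\<in>V. \<Sum>j\<in>V. \<phi> i j) = 2 * (\<Sum>(i, j)\<in>{(i, j). i \<in> V \<and> j \<in> V \<and> i < j}. \<phi> i j)"
proof -
  have "(\<Sum>i\<in>V. \<Sum>j\<in>V. \<phi> i j)
      = (\<Sum>i\<in>V. \<Sum>j\<in>V. (if i < j then \<phi> i j else 0) + (if j < i then \<phi> j i else 0))"
    using diag by (intro sum.cong refl) (auto simp: sym not_less_iff_gr_or_eq)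
  also have "\<dots> = (\<Sum>i\<in>V. \<Sum>j\<in>V. if i < j then \<phi> i j else 0)
      + (\<Sum>i\<in>V. \<Sum>j\<in>V. if j < i then \<phi> j i else 0)"
    by (simp add: sum.distrib)
  also have "(\<Sum>i\<in>V. \<Sum>j\<in>V. if j < i then \<phi> j i else 0)
      = (\<Sum>i\<in>V. \<Sum>j\<in>V. if i < j then \<phi> i j else 0)"
    by (rule sum.swap)
  also have "(\<Sum>i\<in>V. \<Sum>j\<in>V. if i < j then \<phi> i j else 0)
      = (\<Sum>(i, j)\<in>V \<times> V. if i < j then \<phi> i j else 0)"
    by (rule sum.cartesian_product)
  also have "\<dots> = (\<Sum>(i, j)\<in>{(i, j). i \<in> V \<and> j \<in> V \<and> i < j}. \<phi> i j)"
    using V by (intro sum.mono_neutral_cong_right) (auto split: if_splits)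
  finally show ?thesis by simp
qed

lemma clustering_objective_eq_fused:
  assumes w: "\<forall>e. e \<notin> E \<longrightarrow> w e = 0"
  shows "clustering_objective n E w f \<gamma> x = fused_objective {1..n} f (\<lambda>i j. w {i, j}) \<gamma> x"
proof -
  have "(\<Sum>(i, j)\<in>{(i, j). i \<in> {1..n} \<and> j \<in> {1..n} \<and> i < j \<and> {i, j} \<in> E}.
          w {i, j} * norm (x i - x j))
      = (\<Sum>(i, j)\<in>{(i, j). i \<in> {1..n} \<and> j \<in> {1..n} \<and> i < j}. w {i, j} * norm (x i - x j))"
  proof (rule sum.mono_neutral_left)
    show "finite {(i, j). i \<in> {1..n} \<and> j \<in> {1..n} \<and> i < j}"
      by (rule finite_subset[of _ "{1..n} \<times> {1..n}"]) auto
  qed (use w in auto)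
  moreover have "fusion_penalty {1..n} (\<lambda>i j. w {i, j}) x
      = 2 * (\<Sum>(i, j)\<in>{(i, j). i \<in> {1..n} \<and> j \<in> {1..n} \<and> i < j}. w {i, j} * norm (x i - x j))"
    unfolding fusion_penalty_def
    by (rule sum_symmetric_pairs) (auto simp: insert_commute norm_minus_commute)
  ultimately show ?thesis
    unfolding clustering_objective_def fused_objective_def by simp
qed

lemma weight_between_nonneg:
  assumes "\<forall>e. 0 \<le> w e"
  shows "0 \<le> weight_between w A B"
  unfolding weight_between_def using assms by (intro sum_nonneg) blast

lemma weight_between_sym: "weight_between w A B = weight_between w B A"
  unfolding weight_between_def by (subst sum.swap) (simp add: insert_commute)

lemma out_weight_nonneg:
  assumes "\<forall>e. 0 \<le> w e"
  shows "0 \<le> out_weight w N C k"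
  unfolding out_weight_def using weight_between_nonneg[OF assms] by (intro sum_nonneg) blast

lemma GDERIV_cluster_fun:
  fixes f :: "nat \<Rightarrow> 'a::euclidean_space \<Rightarrow> real"
  assumes "\<forall>i\<in>A. smooth_fun (L i) (f i)"
  shows "GDERIV (cluster_fun f A) z :> (\<Sum>i\<in>A. grad (f i) z)"
proof -
  have "cluster_fun f A = (\<lambda>z. \<Sum>i\<in>A. f i z)"
    by (simp add: cluster_fun_def fun_eq_iff)
  then show ?thesis
    using assms by (auto intro: GDERIV_sum smooth_fun_GDERIV)
qed

lemma strictly_convex_sum_unique_minimizer:
  assumes A: "finite A" "A \<noteq> {}" and f: "\<forall>i\<in>A. strictly_convex (f i)"
    and u: "\<And>z. (\<Sum>i\<in>A. f i u) \<le> (\<Sum>i\<in>A. f i z)"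
    and v: "\<And>z. (\<Sum>i\<in>A. f i v) \<le> (\<Sum>i\<in>A. f i z)"
  shows "u = v"
proof (rule ccontr)
  assume ne: "u \<noteq> v"
  define mid where "mid = (1 - 1/2) *\<^sub>R u + (1/2::real) *\<^sub>R v"
  have "(\<Sum>i\<in>A. f i mid) < (\<Sum>i\<in>A. (1 - 1/2) * f i u + 1/2 * f i v)"
  proof (rule sum_strict_mono[OF A])
    fix i assume "i \<in> A"
    then have "u \<noteq> v \<longrightarrow> 0 < (1/2::real) \<longrightarrow> (1/2::real) < 1 \<longrightarrow>
        f i ((1 - 1/2) *\<^sub>R u + (1/2) *\<^sub>R v) < (1 - 1/2) * f i u + 1/2 * f i v"
      using f unfolding strictly_convex_def by blast
    then show "f i mid < (1 - 1/2) * f i u + 1/2 * f i v"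
      using ne unfolding mid_def by simp
  qed
  also have "\<dots> = 1/2 * (\<Sum>i\<in>A. f i u) + 1/2 * (\<Sum>i\<in>A. f i v)"
    by (simp add: sum.distrib sum_divide_distrib)
  finally show False
    using u[of mid] v[of mid] by linarith
qed

section \<open>The thresholds\<close>

lemma gamma_min_le_imp:
  assumes "gamma_min f w N C L \<alpha> \<le> ereal \<gamma>" and "k \<in> {1..N}" "i \<in> C k" "j \<in> C k" "i \<noteq> j"
    and pos: "0 < real (card (C k)) * w {i, j} - mu w N C L \<alpha> k i j"
  shows "norm (grad (f j) (argmin (cluster_fun f (C k))) - grad (f i) (argmin (cluster_fun f (C k))))
    \<le> \<gamma> * (real (card (C k)) * w {i, j} - mu w N C L \<alpha> k i j)" (is "?p \<le> \<gamma> * ?q")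
proof -
  have "ereal ?p / ereal ?q \<le> ereal \<gamma>"
    using assms(1-5) unfolding gamma_min_def SUP_le_iff by fastforce
  then show ?thesis
    using pos by (simp add: pos_divide_le_eq)
qed

text \<open>
  For \<open>q = 0\<close> the quotient is \<open>p * \<infinity>\<close>, and it exceeds the positive \<open>\<gamma>\<close> only if \<open>p\<close> is positive.
\<close>

lemma less_ereal_divide_imp:
  assumes less: "ereal \<gamma> < ereal p / ereal q" and "0 < \<gamma>" "0 \<le> q"
  shows "\<gamma> * q < p"
proof (cases "q = 0")
  case True
  have "0 < ereal p / ereal q"
    using less \<open>0 < \<gamma>\<close> by (metis ereal_less(2) less_trans)
  then show ?thesis
    using True by (simp add: divide_ereal_def ereal_zero_less_0_iff split: if_splits)
next
  case False
  then show ?thesis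
    using assms by (simp add: pos_less_divide_eq)
qed

lemma less_gamma_max_imp:
  assumes "ereal \<gamma> < gamma_max f w N C \<alpha>" "0 < \<gamma>" and k: "k \<in> {1..N}" "k' \<in> {1..N}" "k \<noteq> k'"
    and "0 \<le> 1 / \<alpha> k * out_weight w N C k + 1 / \<alpha> k' * out_weight w N C k'"
  shows "\<gamma> * (1 / \<alpha> k * out_weight w N C k + 1 / \<alpha> k' * out_weight w N C k')
    < norm (argmin (cluster_fun f (C k)) - argmin (cluster_fun f (C k')))"
proof (rule less_ereal_divide_imp)
  show "ereal \<gamma> < ereal (norm (argmin (cluster_fun f (C k)) - argmin (cluster_fun f (C k')))) /
        ereal (1 / \<alpha> k * out_weight w N C k + 1 / \<alpha> k' * out_weight w N C k')"
    using less_INF_D[OF assms(1)[unfolded gamma_max_def], of "(k, k')"] k by simp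
qed fact+

lemma less_gamma_coarse_imp:
  assumes "ereal \<gamma> < gamma_coarse f w N C z" "0 < \<gamma>" "\<forall>e. 0 \<le> w e"
  shows "\<exists>k\<in>{1..N}. \<gamma> * out_weight w N C k < norm (grad (cluster_fun f (C k)) z)"
proof -
  obtain k where k: "k \<in> {1..N}"
    and "ereal \<gamma> < ereal (norm (grad (cluster_fun f (C k)) z)) / ereal (out_weight w N C k)"
    using assms(1) unfolding gamma_coarse_def less_SUP_iff by blast
  then show ?thesis
    using less_ereal_divide_imp[OF _ assms(2) out_weight_nonneg[OF assms(3)]] k by blast
qed

section \<open>The optimal solution is constant on clusters\<close>

text \<open>
  The lower threshold and the assumption on the weights are exactly what turns the distance bound
  between \<open>y k\<close> and the centroid of cluster \<open>k\<close> into the spread condition of the lifting lemma: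
  moving from the centroid to \<open>y k\<close> changes a difference of two gradients by at most the sum of
  their Lipschitz constants times that distance.
\<close>

lemma optimal_solution_is_lift:
  fixes f :: "nat \<Rightarrow> 'a::euclidean_space \<Rightarrow> real"
  assumes w: "\<forall>e. 0 \<le> w e" and weights_off: "\<forall>e. e \<notin> E \<longrightarrow> w e = 0"
    and f_convex: "\<forall>i\<in>{1..n}. strictly_convex (f i)"
    and f_smooth: "\<forall>i\<in>{1..n}. smooth_fun (L i) (f i)"
    and disj: "disjoint_family_on C {1..N}" and cover: "(\<Union>k\<in>{1..N}. C k) = {1..n}"
    and strong: "\<forall>k\<in>{1..N}. strongly_convex (\<alpha> k) (cluster_fun f (C k))"
    and weights_large: "\<forall>k\<in>{1..N}. \<forall>i\<in>C k. \<forall>j\<in>C k. i \<noteq> j \<longrightarrow>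
      real (card (C k)) * w {i, j} > mu w N C L \<alpha> k i j"
    and \<gamma>: "\<gamma> > 0"
    and optimal: "is_arg_min (clustering_objective n E w f \<gamma>) (\<lambda>_. True) x"
    and \<gamma>_min: "gamma_min f w N C L \<alpha> \<le> ereal \<gamma>"
  obtains y where "\<And>k i. k \<in> {1..N} \<Longrightarrow> i \<in> C k \<Longrightarrow> x i = y k"
    and "\<And>z. fused_objective {1..N} (\<lambda>k. cluster_fun f (C k)) (\<lambda>k l. weight_between w (C k) (C l)) \<gamma> y
      \<le> fused_objective {1..N} (\<lambda>k. cluster_fun f (C k)) (\<lambda>k l. weight_between w (C k) (C l)) \<gamma> z"
    and "\<And>k. k \<in> {1..N} \<Longrightarrow> norm (grad (cluster_fun f (C k)) (y k)) \<le> \<gamma> * out_weight w N C k"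
    and "\<And>k. k \<in> {1..N} \<Longrightarrow>
      norm (y k - argmin (cluster_fun f (C k))) \<le> \<gamma> * (1 / \<alpha> k * out_weight w N C k)"
proof -
  define I where "I = {1..N}"
  define V where "V = {1..n}"
  define W where "W = (\<lambda>k l. weight_between w (C k) (C l))"
  define h where "h = (\<lambda>k. cluster_fun f (C k))"
  define c where "c = (\<lambda>k. argmin (h k))"
  define \<kappa> where "\<kappa> = (\<lambda>i. THE k. k \<in> I \<and> i \<in> C k)"
  have fin: "finite I" "finite V"
    by (simp_all add: I_def V_def)
  have CV: "C k \<subseteq> V" if "k \<in> I" for k
    using that cover unfolding I_def V_def by blast
  have \<kappa>_eq: "\<kappa> i = k" if "k \<in> I" "i \<in> C k" for i k
    unfolding \<kappa>_def
  proof (rule the_equality)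
    show "l = k" if "l \<in> I \<and> i \<in> C l" for l
      using that \<open>k \<in> I\<close> \<open>i \<in> C k\<close> disjoint_family_onD[OF disj, of l k] unfolding I_def by blast
  qed (use that in simp)
  have \<kappa>_in: "\<kappa> i \<in> I \<and> i \<in> C (\<kappa> i)" if "i \<in> V" for i
    using that cover \<kappa>_eq unfolding I_def V_def by (metis (no_types, lifting) UN_E)
  then have \<kappa>_I: "\<kappa> ` V \<subseteq> I"
    by blast
  have fib: "fibre V \<kappa> k = C k" if "k \<in> I" for k
    unfolding fibre_def using that \<kappa>_eq \<kappa>_in CV by blast
  have W: "\<forall>k l. 0 \<le> W k l" and W_sym: "\<And>k l. W k l = W l k"
    unfolding W_def using weight_between_nonneg[OF w] weight_between_sym by blast+
  have out: "out_weight w N C k = (\<Sum>l\<in>I - {k}. W k l)" for k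
    by (simp add: out_weight_def I_def W_def)

  have df: "GDERIV (f i) z :> grad (f i) z" if "i \<in> V" for i z
    using f_smooth that smooth_fun_GDERIV unfolding V_def by blast
  have dh_sum: "GDERIV (h k) z :> (\<Sum>i\<in>C k. grad (f i) z)" if "k \<in> I" for k z
    unfolding h_def using CV[OF that] f_smooth
    by (intro GDERIV_cluster_fun[where L = L]) (auto simp: V_def)
  then have dh: "GDERIV (h k) z :> grad (h k) z" if "k \<in> I" for k z
    using that grad_eqI by metis
  have strong': "strongly_convex (\<alpha> k) (h k)" if "k \<in> I" for k
    using strong that by (simp add: h_def I_def)
  then have \<alpha>: "0 < \<alpha> k" if "k \<in> I" for k
    using that strongly_convex_def by blast
  have c_min: "h k (c k) \<le> h k z" if "k \<in> I" for k z
    unfolding c_def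
    by (rule argmin_le, rule strongly_convex_has_minimizer[OF strong'[OF that] dh[OF that]])
  have dc: "GDERIV (h k) (c k) :> 0" if "k \<in> I" for k
    using dh[OF that, of "c k"] grad_eq_zero_at_minimum[OF dh[OF that] c_min[OF that]] by simp

  have "\<exists>y. \<forall>z. fused_objective I h W \<gamma> y \<le> fused_objective I h W \<gamma> z"
  proof (rule fused_has_minimizer[OF fin(1) W, where a = "\<lambda>k. \<alpha> k / 2" and c = c])
    show "continuous_on UNIV (h k)" if "k \<in> I" for k
      using dh[OF that] unfolding gderiv_def
      by (meson continuous_at_imp_continuous_on has_derivative_continuous)
    show "h k (c k) + \<alpha> k / 2 * (norm (z - c k))\<^sup>2 \<le> h k z" if "k \<in> I" for k z
      using strongly_convex_ge_quadratic[OF strong' dc, of k z] that by simp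
  qed (use \<gamma> \<alpha> in auto)
  then obtain y where y: "\<And>z. fused_objective I h W \<gamma> y \<le> fused_objective I h W \<gamma> z"
    by blast
  have grad_le: "norm (grad (h k) (y k)) \<le> \<gamma> * out_weight w N C k" if "k \<in> I" for k
    unfolding out
    by (rule fused_minimizer_grad_le[OF fin(1) W W_sym _ y dh that]) (use \<gamma> in auto)
  have dist_le: "norm (y k - c k) \<le> \<gamma> * (1 / \<alpha> k * out_weight w N C k)" if "k \<in> I" for k
  proof -
    have "\<alpha> k * norm (y k - c k) \<le> norm (grad (h k) (y k))"
      by (rule strongly_convex_dist_minimizer_le[OF strong'[OF that] dh[OF that] dc[OF that]])
    also note grad_le[OF that]
    finally show ?thesis
      using \<alpha>[OF that] by (simp add: field_simps)
  qed

  have lift: "x i = y (\<kappa> i)" if "i \<in> V" for i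
  proof (rule ccontr)
    let ?a = "\<lambda>i j. w {i, j}"
    let ?D = "\<lambda>i. grad (f i) (y (\<kappa> i))"
    assume "x i \<noteq> y (\<kappa> i)"
    \<comment> \<open>The two ways of weighting pairs of clusters agree on the labels in use.\<close>
    have cw: "fusion_penalty I (cluster_weight V \<kappa> ?a) m = fusion_penalty I W m" for m :: "nat \<Rightarrow> 'a"
      unfolding fusion_penalty_def cluster_weight_def W_def weight_between_def
      by (intro sum.cong refl) (simp add: fib)
    have "fused_objective V f ?a \<gamma> (\<lambda>i. y (\<kappa> i)) < fused_objective V f ?a \<gamma> x"
    proof (rule fused_lift_less[OF fin(2,1) \<kappa>_I, where D = ?D])
      show "\<exists>i\<in>V. x i \<noteq> y (\<kappa> i)"
        using \<open>i \<in> V\<close> \<open>x i \<noteq> y (\<kappa> i)\<close> by blast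
    next
      fix m
      have "(\<Sum>i\<in>fibre V \<kappa> k. ?D i) = grad (h k) (y k)" if "k \<in> I" for k
      proof -
        have "(\<Sum>i\<in>fibre V \<kappa> k. ?D i) = (\<Sum>i\<in>C k. grad (f i) (y k))"
          unfolding fib[OF that] using \<kappa>_eq[OF that] by (intro sum.cong refl) simp
        also have "\<dots> = grad (h k) (y k)"
          using grad_eqI[OF dh_sum[OF that]] by simp
        finally show ?thesis .
      qed
      then show "\<gamma> / 2 * fusion_penalty I (cluster_weight V \<kappa> ?a) y
          \<le> (\<Sum>k\<in>I. inner (\<Sum>i\<in>fibre V \<kappa> k. ?D i) (m k - y k))
            + \<gamma> / 2 * fusion_penalty I (cluster_weight V \<kappa> ?a) m"
        using fused_minimizer_first_order[OF W _ y dh, of m] \<gamma> by (simp add: cw)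
    next
      fix i z assume "i \<in> V" "z \<noteq> y (\<kappa> i)"
      then show "f i (y (\<kappa> i)) + inner (?D i) (z - y (\<kappa> i)) < f i z"
        using f_convex by (intro strictly_convex_gt_tangent df) (auto simp: V_def)
    next
      fix i j assume i: "i \<in> V" and j: "j \<in> V" and same: "\<kappa> i = \<kappa> j" and ij: "i \<noteq> j"
      define k where "k = \<kappa> i"
      have k: "k \<in> I" "i \<in> C k" "j \<in> C k"
        using \<kappa>_in[OF i] \<kappa>_in[OF j] same by (simp_all add: k_def)
      \<comment> \<open>\<open>S\<close> is the part of \<open>mu\<close> that pays for the uneven pull of the other clusters; the
        rest pays for the distance from the centroid to \<open>y k\<close>.\<close>
      define S where "S = (\<Sum>l\<in>I - {k}. \<bar>weight_to w (C l) i - weight_to w (C l) j\<bar>)"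
      define q where "q = real (card (C k)) * w {i, j} - mu w N C L \<alpha> k i j"
      have S_eq: "(\<Sum>l\<in>I - {k}. \<bar>(\<Sum>v\<in>fibre V \<kappa> l. w {i, v}) - (\<Sum>v\<in>fibre V \<kappa> l. w {j, v})\<bar>) = S"
        unfolding S_def weight_to_def by (intro sum.cong refl) (simp add: fib)
      have mu: "mu w N C L \<alpha> k i j = S + (L i + L j) / \<alpha> k * out_weight w N C k"
        by (simp add: mu_def S_def I_def)
      have "0 < q"
        using weights_large k ij unfolding q_def I_def by fastforce
      then have centre: "norm (grad (f j) (c k) - grad (f i) (c k)) \<le> \<gamma> * q"
        using gamma_min_le_imp[OF \<gamma>_min _ k(2,3) ij] k(1) unfolding q_def c_def h_def I_def by simp
      have lip: "norm (grad (f v) (y k) - grad (f v) (c k)) \<le> L v * norm (y k - c k)"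
        and L: "0 < L v" if "v \<in> V" for v
        using f_smooth that unfolding smooth_fun_def V_def by auto
      have "norm (grad (f i) (y k) - grad (f j) (y k))
          \<le> norm (grad (f j) (c k) - grad (f i) (c k))
            + norm (grad (f i) (y k) - grad (f i) (c k)) + norm (grad (f j) (y k) - grad (f j) (c k))"
        by norm
      also have "\<dots> \<le> \<gamma> * q + (L i + L j) * norm (y k - c k)"
        using centre lip[OF i] lip[OF j] by (simp add: distrib_right)
      also have "\<dots> \<le> \<gamma> * q + (L i + L j) * (\<gamma> * (1 / \<alpha> k * out_weight w N C k))"
        using dist_le[OF k(1)] L[OF i] L[OF j] by (intro add_left_mono mult_left_mono) auto
      finally have "norm (grad (f i) (y k) - grad (f j) (y k)) + \<gamma> * S
          \<le> \<gamma> * (real (card (C k)) * w {i, j})"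
        unfolding q_def mu by (simp add: algebra_simps)
      then show "norm (?D i - ?D j) + \<gamma> * (\<Sum>l\<in>I - {\<kappa> i}.
          \<bar>(\<Sum>v\<in>fibre V \<kappa> l. w {i, v}) - (\<Sum>v\<in>fibre V \<kappa> l. w {j, v})\<bar>)
          \<le> \<gamma> * (real (card (fibre V \<kappa> (\<kappa> i))) * w {i, j})"
        using S_eq fib[OF k(1)] same by (simp add: k_def)
    qed (use w \<gamma> in \<open>auto simp: insert_commute\<close>)
    then have "clustering_objective n E w f \<gamma> (\<lambda>i. y (\<kappa> i)) < clustering_objective n E w f \<gamma> x"
      unfolding clustering_objective_eq_fused[OF weights_off] V_def .
    then show False
      using optimal by (auto simp: is_arg_min_def)
  qed
  show thesis
  proof (rule that)
    show "x i = y k" if "k \<in> {1..N}" "i \<in> C k" for k i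
      using lift[of i] \<kappa>_eq[of k i] CV[of k] that unfolding I_def by auto
  qed (use y grad_le dist_le in \<open>auto simp: I_def h_def W_def c_def\<close>)
qed

section \<open>Partitions\<close>

lemma induced_partition_eq:
  "induced_partition n x = (\<lambda>i. {j \<in> {1..n}. x j = x i}) ` {1..n}"
proof -
  have "{(i, j). i \<in> {1..n} \<and> j \<in> {1..n} \<and> x i = x j} `` {i} = {j \<in> {1..n}. x j = x i}"
    if "i \<in> {1..n}" for i
    using that by fastforce
  then show ?thesis
    unfolding induced_partition_def quotient_def by auto
qed

lemma partition_on_induced_partition: "partition_on {1..n} (induced_partition n x)"
  unfolding induced_partition_def
  by (rule partition_on_quotient, rule equivI) (auto simp: refl_on_def sym_def trans_def)

lemma partition_on_image:
  assumes "disjoint_family_on C I" "(\<Union>k\<in>I. C k) = V" "\<And>k. k \<in> I \<Longrightarrow> C k \<noteq> {}"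
  shows "partition_on V (C ` I)"
  using assms by (auto simp: partition_on_def disjoint_family_on_disjoint_image)

lemma coarsening_induced_partition:
  assumes P: "partition_on {1..n} (C ` I)" and cover: "(\<Union>k\<in>I. C k) = {1..n}"
    and x: "\<And>k i. k \<in> I \<Longrightarrow> i \<in> C k \<Longrightarrow> x i = y k"
  shows "coarsening {1..n} (induced_partition n x) (C ` I)"
proof -
  have "\<exists>J\<subseteq>C ` I. {j \<in> {1..n}. x j = x i} = \<Union>J" for i
  proof (intro exI conjI)
    show "{j \<in> {1..n}. x j = x i} = \<Union>(C ` {k \<in> I. y k = x i})"
    proof (intro set_eqI iffI)
      fix j assume "j \<in> {j \<in> {1..n}. x j = x i}"
      then obtain k where "k \<in> I" "j \<in> C k" "x j = x i"
        using cover by blast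
      then show "j \<in> \<Union>(C ` {k \<in> I. y k = x i})"
        using x by auto
    qed (use x cover in auto)
  qed blast
  then show ?thesis
    using P partition_on_induced_partition unfolding coarsening_def
    by (auto simp: induced_partition_eq)
qed

lemma induced_partition_eq_clusters:
  assumes ne: "\<And>k. k \<in> I \<Longrightarrow> C k \<noteq> {}" and cover: "(\<Union>k\<in>I. C k) = {1..n}"
    and x: "\<And>k i. k \<in> I \<Longrightarrow> i \<in> C k \<Longrightarrow> x i = y k" and inj: "inj_on y I"
  shows "induced_partition n x = C ` I"
proof -
  have cls: "{j \<in> {1..n}. x j = x i} = C k" if "k \<in> I" "i \<in> C k" for k i
  proof -
    have "j \<in> C k" if j: "j \<in> {1..n}" "x j = x i" for j
    proof -
      obtain l where l: "l \<in> I" "j \<in> C l"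
        using j cover by blast
      then have "y l = y k"
        using x j \<open>k \<in> I\<close> \<open>i \<in> C k\<close> by metis
      then show ?thesis
        using inj l \<open>k \<in> I\<close> by (auto dest: inj_onD)
    qed
    then show ?thesis
      using that x cover by auto
  qed
  show ?thesis
  proof
    show "induced_partition n x \<subseteq> C ` I"
      unfolding induced_partition_eq using cls cover by blast
    show "C ` I \<subseteq> induced_partition n x"
    proof
      fix D assume "D \<in> C ` I"
      then obtain k i where "D = C k" "k \<in> I" "i \<in> C k"
        using ne by blast
      then show "D \<in> induced_partition n x"
        unfolding induced_partition_eq using cls cover by blast
    qed
  qed
qed

theorem theorem1:
  fixes n N :: nat
    and E :: "nat set set"
    and w :: "nat set \<Rightarrow> real"
    and f :: "nat \<Rightarrow> real ^ 'p \<Rightarrow> real"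
    and L \<alpha> :: "nat \<Rightarrow> real"
    and C :: "nat \<Rightarrow> nat set"
    and \<gamma> :: real
    and x :: "nat \<Rightarrow> real ^ 'p"
  assumes edges: "E \<subseteq> {{i, j} | i j. i \<in> {1..n} \<and> j \<in> {1..n} \<and> i \<noteq> j}"
    and weights_nonneg: "\<forall>e\<in>E. w e \<ge> 0"
    and weights_off: "\<forall>e. e \<notin> E \<longrightarrow> w e = 0"
    and f_convex: "\<forall>i\<in>{1..n}. strictly_convex (f i)"
    and f_smooth: "\<forall>i\<in>{1..n}. smooth_fun (L i) (f i)"
    and clusters_disjoint: "disjoint_family_on C {1..N}"
    and clusters_cover: "(\<Union>k\<in>{1..N}. C k) = {1..n}"
    and cluster_strong: "\<forall>k\<in>{1..N}. strongly_convex (\<alpha> k) (cluster_fun f (C k))"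
    and centroids_distinct: "\<forall>k\<in>{1..N}. \<forall>k'\<in>{1..N}. k \<noteq> k' \<longrightarrow>
      argmin (cluster_fun f (C k)) \<noteq> argmin (cluster_fun f (C k'))"
    and weights_large: "\<forall>k\<in>{1..N}. \<forall>i\<in>C k. \<forall>j\<in>C k. i \<noteq> j \<longrightarrow>
      real (card (C k)) * w {i, j} > mu w N C L \<alpha> k i j"
    and gamma_pos: "\<gamma> > 0"
    and optimal: "is_arg_min (clustering_objective n E w f \<gamma>) (\<lambda>_. True) x"
  shows "(gamma_min f w N C L \<alpha> \<le> ereal \<gamma> \<and> ereal \<gamma> < gamma_max f w N C \<alpha> \<longrightarrow>
            perfectly_recovers (induced_partition n x) (C ` {1..N})) \<and>
         argmin (\<lambda>y. \<Sum>k\<in>{1..N}. cluster_fun f (C k) y) = argmin (\<lambda>y. \<Sum>i\<in>{1..n}. f i y) \<and>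
         (gamma_min f w N C L \<alpha> \<le> ereal \<gamma> \<and>
          ereal \<gamma> < gamma_coarse f w N C (argmin (\<lambda>y. \<Sum>i\<in>{1..n}. f i y)) \<longrightarrow>
            nontrivial_coarsening {1..n} (induced_partition n x) (C ` {1..N}))"
proof (intro conjI impI)
  have w: "\<forall>e. 0 \<le> w e"
    using weights_nonneg weights_off by (metis order_refl)
  have \<alpha>: "0 < \<alpha> k" if "k \<in> {1..N}" for k
    using cluster_strong that by (simp add: strongly_convex_def)
  have nonempty: "C k \<noteq> {}" if "k \<in> {1..N}" for k
  proof
    assume "C k = {}"
    then have "cluster_fun f (C k) = (\<lambda>_. 0)"
      by (simp add: cluster_fun_def fun_eq_iff)
    then show False
      using cluster_strong that not_strongly_convex_zero by metis
  qed
  have finC: "finite (C k)" if "k \<in> {1..N}" for k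
    using clusters_cover that by (metis UN_upper finite_atLeastAtMost finite_subset)
  have sum_eq: "(\<Sum>k\<in>{1..N}. cluster_fun f (C k) z) = (\<Sum>i\<in>{1..n}. f i z)" for z
    unfolding cluster_fun_def clusters_cover[symmetric]
    using finC clusters_disjoint
    by (intro sum.UNION_disjoint[symmetric]) (auto simp: disjoint_family_on_def)
  then show "argmin (\<lambda>y. \<Sum>k\<in>{1..N}. cluster_fun f (C k) y) = argmin (\<lambda>y. \<Sum>i\<in>{1..n}. f i y)"
    by simp
  note is_lift = optimal_solution_is_lift[OF w weights_off f_convex f_smooth clusters_disjoint
      clusters_cover cluster_strong weights_large gamma_pos optimal]

  show "perfectly_recovers (induced_partition n x) (C ` {1..N})"
    if \<gamma>: "gamma_min f w N C L \<alpha> \<le> ereal \<gamma> \<and> ereal \<gamma> < gamma_max f w N C \<alpha>"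
  proof -
    obtain y where xy: "\<And>k i. k \<in> {1..N} \<Longrightarrow> i \<in> C k \<Longrightarrow> x i = y k"
      and near: "\<And>k. k \<in> {1..N} \<Longrightarrow>
        norm (y k - argmin (cluster_fun f (C k))) \<le> \<gamma> * (1 / \<alpha> k * out_weight w N C k)"
      by (rule is_lift[OF conjunct1[OF \<gamma>]]) (rule that)
    have "inj_on y {1..N}"
    proof (rule inj_onI, rule ccontr)
      fix k l assume k: "k \<in> {1..N}" and l: "l \<in> {1..N}" and y: "y k = y l" and ne: "k \<noteq> l"
      let ?c = "\<lambda>k. argmin (cluster_fun f (C k))"
      have "norm (?c k - ?c l) \<le> norm (y k - ?c k) + norm (y l - ?c l)"
        unfolding y by norm
      also have "\<dots> \<le> \<gamma> * (1 / \<alpha> k * out_weight w N C k + 1 / \<alpha> l * out_weight w N C l)"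
        using near[OF k] near[OF l] by (simp add: distrib_left)
      also have "\<dots> < norm (?c k - ?c l)"
        using \<gamma> gamma_pos \<alpha>[OF k] \<alpha>[OF l] out_weight_nonneg[OF w, of N C]
        by (intro less_gamma_max_imp k l ne add_nonneg_nonneg mult_nonneg_nonneg) auto
      finally show False by simp
    qed
    then show ?thesis
      unfolding perfectly_recovers_def
      by (intro induced_partition_eq_clusters[where y = y] nonempty clusters_cover xy)
  qed

  show "nontrivial_coarsening {1..n} (induced_partition n x) (C ` {1..N})"
    if \<gamma>: "gamma_min f w N C L \<alpha> \<le> ereal \<gamma> \<and>
      ereal \<gamma> < gamma_coarse f w N C (argmin (\<lambda>y. \<Sum>i\<in>{1..n}. f i y))"
  proof -
    let ?F = "fused_objective {1..N} (\<lambda>k. cluster_fun f (C k)) (\<lambda>k l. weight_between w (C k) (C l)) \<gamma>"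
    obtain y where xy: "\<And>k i. k \<in> {1..N} \<Longrightarrow> i \<in> C k \<Longrightarrow> x i = y k"
      and y_min: "\<And>z. ?F y \<le> ?F z"
      and grad_le: "\<And>k. k \<in> {1..N} \<Longrightarrow>
        norm (grad (cluster_fun f (C k)) (y k)) \<le> \<gamma> * out_weight w N C k"
      by (rule is_lift[OF conjunct1[OF \<gamma>]]) (rule that)
    have "coarsening {1..n} (induced_partition n x) (C ` {1..N})"
      by (intro coarsening_induced_partition[where y = y] partition_on_image clusters_disjoint clusters_cover
          nonempty xy)
    moreover have "induced_partition n x \<noteq> {{1..n}}"
    proof
      define xbar where "xbar = argmin (\<lambda>y. \<Sum>i\<in>{1..n}. f i y)"
      assume trivial: "induced_partition n x = {{1..n}}"
      obtain k where k: "k \<in> {1..N}"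
        and grad_gt: "\<gamma> * out_weight w N C k < norm (grad (cluster_fun f (C k)) xbar)"
        using less_gamma_coarse_imp[OF _ gamma_pos w] \<gamma> unfolding xbar_def by blast
      have y_const: "y l = y k" if l: "l \<in> {1..N}" for l
      proof -
        obtain i j where ij: "i \<in> C k" "j \<in> C l"
          using nonempty k l by blast
        then have V: "i \<in> {1..n}" "j \<in> {1..n}"
          using clusters_cover k l by blast+
        have "{j \<in> {1..n}. x j = x i} \<in> induced_partition n x"
          unfolding induced_partition_eq using V(1) by blast
        then have "x j = x i"
          using trivial V(2) by auto
        then show ?thesis
          using xy k l ij by metis
      qed
      \<comment> \<open>At constant points the penalty vanishes, so \<open>y\<close> beats every other constant point.\<close>
      have min: "(\<Sum>i\<in>{1..n}. f i (y k)) \<le> (\<Sum>i\<in>{1..n}. f i z)" for z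
      proof -
        have "?F y = (\<Sum>l\<in>{1..N}. cluster_fun f (C l) (y k))"
          using y_const by (simp add: fused_objective_def fusion_penalty_def)
        moreover have "?F (\<lambda>_. z) = (\<Sum>l\<in>{1..N}. cluster_fun f (C l) z)"
          by (simp add: fused_objective_def fusion_penalty_def)
        ultimately show ?thesis
          using y_min[of "\<lambda>_. z"] sum_eq by simp
      qed
      have "{1..n} \<noteq> {}"
        using clusters_cover nonempty k by blast
      then have "y k = xbar"
        using min argmin_le[of "\<lambda>y. \<Sum>i\<in>{1..n}. f i y"] f_convex unfolding xbar_def
        by (intro strictly_convex_sum_unique_minimizer[of "{1..n}" f]) auto
      then show False
        using grad_le[OF k] grad_gt by simp
    qed
    ultimately show ?thesis
      unfolding nontrivial_coarsening_def by blast
  qed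
qed

end
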